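(* Let $\mathbb{D}$ be a string diagram of MDPs, $\mathbf{w}=(w_o)_o\in[0,1]^{O^{[\![\mathbb{D}]\!]}}$ a weight on its global exits, and $\epsilon\in[0,1]$. Consider CVI (compositional value iteration with Pareto caching, as described in the context) with either the optimistic global stopping criterion (Opt-GSC) or the bottom-up global stopping criterion (BU-GSC). If CVI terminates, then its output $f\colon I^{[\![\mathbb{D}]\!]}\to[0,1]$ satisfies, for every global entrance $i\in I^{[\![\mathbb{D}]\!]}$, $$f(i)\;\le\;\mathrm{WRPr}^{[\![\mathbb{D}]\!]}_{\max}(\mathbf{w},i)\;\le\; f(i)+\epsilon .$$
   Context: **MDPs.** An MDP is $(S,A,P)$ with finite sets $S$ (states) and $A$ (actions) and a partial function $P\colon S\times A\rightharpoonup\mathcal{D}(S)$, where $\mathcal D(X)$ is the set of probability distributions on $X$. Write $P(s,a,s')$ for $P(s,a)(s')$, with $P(s,a,s')=0$ when $P(s,a)$ is undefined. A (memoryless) scheduler is $\sigma\colon S\to\mathcal{D}(A)$; it is deterministic memoryless (DM) if every $\sigma(s)$ is Dirac. For a target state $t$, the reachability probability $\mathrm{RPr}^{\sigma,t}(s)$ is the sum, over all finite paths $\pi=(\pi_1,\dots,\pi_m)$ with $\pi_1=s$, $\pi_m=t$ and $\pi_j\ne t$ for $j<m$, of $\prod_{j=1}^{m-1}\sum_{a\in A}\sigma(\pi_j)(a)\,P(\pi_j,a,\pi_{j+1})$. **Open MDPs.** An open MDP (oMDP) $\mathcal{A}$ is an MDP $(S^{\mathcal A},A^{\mathcal A},P^{\mathcal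 A})$ with pairwise disjoint, totally ordered subsets $I_{\mathbf r},I_{\mathbf l},O_{\mathbf r},O_{\mathbf l}\subseteq S^{\mathcal A}$; $I^{\mathcal A}=I_{\mathbf r}\cup I_{\mathbf l}$ are the entrances and $O^{\mathcal A}=O_{\mathbf r}\cup O_{\mathbf l}$ the exits; $P(s,a)$ is undefined for every exit $s$ and every $a$. Its arity is $(|I_{\mathbf r}|,|O_{\mathbf l}|)\to(|O_{\mathbf r}|,|I_{\mathbf l}|)$. For a weight $\mathbf v\in[0,1]^{O^{\mathcal A}}$ and a state $s$, $\mathrm{WRPr}^{\mathcal A}_{\max}(\mathbf v,s)=\sup_\sigma\sum_{o\in O^{\mathcal A}}v_o\,\mathrm{RPr}^{\mathcal A,\sigma,o}(s)$, over memoryless schedulers $\sigma$. **Compositions.** For $\mathcal A,\mathcal B$ of arities $(m_{\mathbf r},m_{\mathbf l})\to(l_{\mathbf r},l_{\mathbf l})$ and $(l_{\mathbf r},l_{\mathbf l})\to(n_{\mathbf r},n_{\mathbf l})$, the sequential composition $\mathcal A;\mathcal B$ has state set $(S^{\mathcal A}\uplus S^{\mathcal B})\setminus(O^{\mathcal A}_{\mathbf r}\uplus O^{\mathcal B}_{\mathbf l})$, actions $A^{\mathcal A}\uplus A^{\mathcal B}$, open ends $(I^{\mathcal A}_{\mathbf r},I^{\mathcal B}_{\mathbf l},O^{\mathcal B}_{\mathbf r},O^{\mathcal A}_{\mathbf l})$ (in the order $I_{\mathbf r},I_{\mathbf l},O_{\mathbf r},O_{\mathbf l}$), and the transitions of $\mathcal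 A$ and $\mathcal B$, except that every transition of $\mathcal A$ into its $j$-th exit in $O^{\mathcal A}_{\mathbf r}$ is redirected to the $j$-th entrance in $I^{\mathcal B}_{\mathbf r}$, and every transition of $\mathcal B$ into its $j$-th exit in $O^{\mathcal B}_{\mathbf l}$ is redirected to the $j$-th entrance in $I^{\mathcal A}_{\mathbf l}$. The sum $\mathcal A\oplus\mathcal B$ is the disjoint union, with open ends $(I^{\mathcal A}_{\mathbf r}\uplus I^{\mathcal B}_{\mathbf r},\dots,O^{\mathcal A}_{\mathbf l}\uplus O^{\mathcal B}_{\mathbf l})$. **String diagrams.** A string diagram is a term $\mathbb D::=\mathsf c_{\mathcal A}\mid\mathbb D;\mathbb D\mid\mathbb D\oplus\mathbb D$ with matching arities, where $\mathsf c_{\mathcal A}$ is a constant for an oMDP $\mathcal A$. Its semantics $[\![\mathbb D]\!]$ is the oMDP defined inductively by $[\![\mathsf c_{\mathcal A}]\!]=\mathcal A$, $[\![\mathbb D_1;\mathbb D_2]\!]=[\![\mathbb D_1]\!];[\![\mathbb D_2]\!]$ (sequential composition of oMDPs) and $[\![\mathbb D_1\oplus\mathbb D_2]\!]=[\![\mathbb D_1]\!]\oplus[\![\mathbb D_2]\!]$ (sum of oMDPs). Global entrances and exits are $I^{[\![\mathbb D]\!]}$ and $O^{[\![\mathbb D]\!]}$. $\mathrm{CP}(\mathbb D)$ is the set of components, i.e. occurrences of oMDPs in $\mathbb D$, counted with multiplicity; $\mathrm{nCP}(\mathbb D)$ is the set of constants occurring in $\mathbb D$ (without multiplicity). Local entrances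 and exits: $I_{\mathrm{lc}}(\mathbb D)=\biguplus_{\mathcal A\in \mathrm{CP}(\mathbb D)}I^{\mathcal A}$, $O_{\mathrm{lc}}(\mathbb D)=\biguplus_{\mathcal A\in \mathrm{CP}(\mathbb D)}O^{\mathcal A}$; $I^{[\![\mathbb D]\!]}\subseteq I_{\mathrm{lc}}(\mathbb D)$ and $O^{[\![\mathbb D]\!]}\subseteq O_{\mathrm{lc}}(\mathbb D)$. Each local exit $o$ that is not global was removed by exactly one sequential composition; $i_o\in I_{\mathrm{lc}}(\mathbb D)$ denotes the local entrance to which its incoming transitions were redirected there. **Propagation.** For $g\colon I_{\mathrm{lc}}(\mathbb D)\to[0,1]$, $\mathrm{Propagate}(g,\mathbf w)\colon O_{\mathrm{lc}}(\mathbb D)\to[0,1]$ maps a global exit $o$ to $w_o$ and any other local exit $o$ to $g(i_o)$. **Sound approximations.** For an oMDP $\mathcal A$, entrance $i$ and scheduler $\sigma$, let $\mathbf p^\sigma_i=(\mathrm{RPr}^{\mathcal A,\sigma,o}(i))_{o\in O^{\mathcal A}}$. The set of achievable points is $\mathsf{Ach}_i=\{\mathbf p\in[0,1]^{O^{\mathcal A}}\mid \mathbf p\le\mathbf p^\sigma_i\text{ componentwise for some }\sigma\}$. An under-approximation at $i$ is a downward closed set $L_i\subseteq\mathsf{Ach}_i$; an over-approximation at $i$ is a downward closed set $U_i\supseteq\mathsf{Ach}_i$ (inside $[0,1]^{O^{\mathcal A}}$). A Pareto cache is a family $(L^{\mathcal A},U^{\mathcal A})$ indexed by $\mathsf c_{\mathcal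 A}\in\mathrm{nCP}(\mathbb D)$, with $L^{\mathcal A}=(L^{\mathcal A}_i)_{i\in I^{\mathcal A}}$ and $U^{\mathcal A}=(U^{\mathcal A}_i)_{i\in I^{\mathcal A}}$. A cache read at weight $\mathbf v$ is $L^{\mathcal A}_i(\mathbf v)=\sup_{\mathbf p\in L^{\mathcal A}_i}\mathbf v\cdot\mathbf p$ and $U^{\mathcal A}_i(\mathbf v)=\sup_{\mathbf p\in U^{\mathcal A}_i}\mathbf v\cdot\mathbf p$ (with $\sup\emptyset=0$). **CVI.** Fix a local tolerance $\eta\in[0,1]$. Initialize $g\colon I_{\mathrm{lc}}(\mathbb D)\to[0,1]$ as $0$; $h\colon O_{\mathrm{lc}}(\mathbb D)\to[0,1]$ by $h(o)=w_o$ on global exits and $0$ elsewhere; and the cache by $L^{\mathcal A}_i=\emptyset$, $U^{\mathcal A}_i=[0,1]^{O^{\mathcal A}}$. While the global stopping criterion is false, execute a round. For each $\mathcal A\in\mathrm{CP}(\mathbb D)$, with $\mathbf v=h|_{O^{\mathcal A}}$: - (cache hit) if $\max_{i\in I^{\mathcal A}}(U^{\mathcal A}_i(\mathbf v)-L^{\mathcal A}_i(\mathbf v))\le\eta$, let $g_{\mathcal A}(i)=L^{\mathcal A}_i(\mathbf v)$ for $i\in I^{\mathcal A}$; - (cache miss) otherwise, run a sound local value iteration on $\mathcal A$ with weight $\mathbf v$, yielding numbers $l(i)\le\mathrm{WRPr}^{\mathcal A}_{\max}(\mathbf v,i)\le u(i)$ in $[0,1]$ with $u(i)-l(i)\le\eta$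 for each $i\in I^{\mathcal A}$ and a DM scheduler $\sigma$ of $\mathcal A$; let $g_{\mathcal A}=l$, and update the cache by replacing, for each $i$, $L^{\mathcal A}_i$ with the downward and convex closure of $L^{\mathcal A}_i\cup\{\mathbf p^\sigma_i\}$ and $U^{\mathcal A}_i$ with $U^{\mathcal A}_i\cap\{\mathbf p\mid\mathbf v\cdot\mathbf p\le u(i)\}$. Then let $g$ be the function on $I_{\mathrm{lc}}(\mathbb D)$ with $g|_{I^{\mathcal A}}=g_{\mathcal A}$ for each $\mathcal A$, and set $h:=\mathrm{Propagate}(g,\mathbf w)$. When the loop stops, output $f=g|_{I^{[\![\mathbb D]\!]}}$. **Opt-GSC.** Define $\Psi$ on functions $x\colon I_{\mathrm{lc}}(\mathbb D)\to[0,1]$ by $\Psi(x)(i)=\max_{\sigma}\sum_{o\in O^{\mathcal A}}\mathrm{RPr}^{\mathcal A,\sigma,o}(i)\cdot\mathrm{Propagate}(x,\mathbf w)(o)$ for $i\in I^{\mathcal A}$, $\mathcal A\in\mathrm{CP}(\mathbb D)$, with $\sigma$ ranging over DM schedulers of $\mathcal A$. The criterion heuristically (arbitrarily) picks a candidate $x\colon I_{\mathrm{lc}}(\mathbb D)\to[0,1]$ with $|x(i)-g(i)|\le\epsilon$ for all $i$, and is true iff $\Psi(x)\le x$ pointwise. **BU-GSC.** From the current cache sets $U^{\mathcal A}$ one computes, inductively along the structure of $\mathbb D$, a family $U=(U_i)_{i\in I^{[\![\mathbb D]\!]}}$ with $U_i\subseteq[0,1]^{O^{[\![\mathbb D]\!]}}$,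 using a bottom-up combination procedure for $;$ and $\oplus$ which is known to turn over-approximations for two oMDPs (at all entrances) into over-approximations for their composite (at all entrances). The criterion is true iff $\sup_{\mathbf p\in U_i}\mathbf w\cdot\mathbf p\le g(i)+\epsilon$ for every $i\in I^{[\![\mathbb D]\!]}$. *)

theory Defs
  imports "HOL-Probability.Probability"
begin

section \<open>MDPs and reachability probabilities\<close>

record ('s, 'a) mdp =
  states :: "'s set"
  acts :: "'a set"
  tr :: "'s \<Rightarrow> 'a \<Rightarrow> 's pmf option"

definition is_mdp :: "('s, 'a, 'z) mdp_scheme \<Rightarrow> bool" where
  "is_mdp M \<longleftrightarrow> finite (states M) \<and> finite (acts M) \<and>
     (\<forall>s a d. tr M s a = Some d \<longrightarrow> s \<in> states M \<and> a \<in> acts M \<and> set_pmf d \<subseteq> states M)"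

definition tr_prob :: "('s, 'a, 'z) mdp_scheme \<Rightarrow> 's \<Rightarrow> 'a \<Rightarrow> 's \<Rightarrow> real" where
  "tr_prob M s a s' = (case tr M s a of None \<Rightarrow> 0 | Some d \<Rightarrow> pmf d s')"

definition schedulers :: "('s, 'a, 'z) mdp_scheme \<Rightarrow> ('s \<Rightarrow> 'a pmf) set" where
  "schedulers M = (states M \<rightarrow>\<^sub>E {d. set_pmf d \<subseteq> acts M})"

definition dm_schedulers :: "('s, 'a, 'z) mdp_scheme \<Rightarrow> ('s \<Rightarrow> 'a pmf) set" where
  "dm_schedulers M = (states M \<rightarrow>\<^sub>E return_pmf ` acts M)"

definition paths_to :: "('s, 'a, 'z) mdp_scheme \<Rightarrow> 's \<Rightarrow> 's \<Rightarrow> 's list set" where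
  "paths_to M s t =
     {\<pi>. \<pi> \<noteq> [] \<and> set \<pi> \<subseteq> states M \<and> hd \<pi> = s \<and> last \<pi> = t \<and> t \<notin> set (butlast \<pi>)}"

definition path_prob :: "('s, 'a, 'z) mdp_scheme \<Rightarrow> ('s \<Rightarrow> 'a pmf) \<Rightarrow> 's list \<Rightarrow> real" where
  "path_prob M \<sigma> \<pi> =
     (\<Prod>j<length \<pi> - 1. \<Sum>a\<in>acts M. pmf (\<sigma> (\<pi> ! j)) a * tr_prob M (\<pi> ! j) a (\<pi> ! Suc j))"

definition RPr :: "('s, 'a, 'z) mdp_scheme \<Rightarrow> ('s \<Rightarrow> 'a pmf) \<Rightarrow> 's \<Rightarrow> 's \<Rightarrow> real" where
  "RPr M \<sigma> t s = (\<Sum>\<^sub>\<infinity>\<pi>\<in>paths_to M s t. path_prob M \<sigma> \<pi>)"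

text \<open>Supremum of a set of nonnegative reals, with value 0 on the empty set.\<close>

definition sup0 :: "real set \<Rightarrow> real" where
  "sup0 X = Sup (insert 0 X)"


section \<open>Open MDPs\<close>

text \<open>The totally ordered sets of open ends are duplicate-free lists.\<close>

record ('s, 'a) omdp = "('s, 'a) mdp" +
  in_r :: "'s list"
  in_l :: "'s list"
  out_r :: "'s list"
  out_l :: "'s list"

definition entrances :: "('s, 'a) omdp \<Rightarrow> 's set" where
  "entrances A = set (in_r A) \<union> set (in_l A)"

definition exits :: "('s, 'a) omdp \<Rightarrow> 's set" where
  "exits A = set (out_r A) \<union> set (out_l A)"

definition is_omdp :: "('s, 'a) omdp \<Rightarrow> bool" where
  "is_omdp A \<longleftrightarrow> is_mdp A \<and> distinct (in_r A @ in_l A @ out_r A @ out_l A) \<and>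
     entrances A \<union> exits A \<subseteq> states A \<and> (\<forall>s\<in>exits A. \<forall>a. tr A s a = None)"

definition dom_arity :: "('s, 'a) omdp \<Rightarrow> nat \<times> nat" where
  "dom_arity A = (length (in_r A), length (out_l A))"

definition cod_arity :: "('s, 'a) omdp \<Rightarrow> nat \<times> nat" where
  "cod_arity A = (length (out_r A), length (in_l A))"

definition wsum :: "('s, 'a) omdp \<Rightarrow> ('s \<Rightarrow> real) \<Rightarrow> ('s \<Rightarrow> real) \<Rightarrow> real" where
  "wsum A v p = (\<Sum>e\<in>exits A. v e * p e)"

definition reach_pt :: "('s, 'a) omdp \<Rightarrow> ('s \<Rightarrow> 'a pmf) \<Rightarrow> 's \<Rightarrow> 's \<Rightarrow> real" where
  "reach_pt A \<sigma> i = (\<lambda>e\<in>exits A. RPr A \<sigma> e i)"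

definition WRPr_max :: "('s, 'a) omdp \<Rightarrow> ('s \<Rightarrow> real) \<Rightarrow> 's \<Rightarrow> real" where
  "WRPr_max A v s = sup0 ((\<lambda>\<sigma>. \<Sum>e\<in>exits A. v e * RPr A \<sigma> e s) ` schedulers A)"


section \<open>Compositions\<close>

text \<open>
  The pairs (removed exit, entrance taking over its incoming transitions) of a sequential
  composition.
\<close>

definition seq_links ::
  "('s, 'a) omdp \<Rightarrow> ('t, 'b) omdp \<Rightarrow> (('s + 't) \<times> ('s + 't)) list" where
  "seq_links A B = zip (map Inl (out_r A)) (map Inr (in_r B)) @
                   zip (map Inr (out_l B)) (map Inl (in_l A))"

definition redirect :: "('s, 'a) omdp \<Rightarrow> ('t, 'b) omdp \<Rightarrow> 's + 't \<Rightarrow> 's + 't" where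
  "redirect A B x = (case map_of (seq_links A B) x of None \<Rightarrow> x | Some y \<Rightarrow> y)"

fun union_tr :: "('s + 't \<Rightarrow> 's + 't) \<Rightarrow> ('s, 'a) omdp \<Rightarrow> ('t, 'b) omdp \<Rightarrow>
    's + 't \<Rightarrow> 'a + 'b \<Rightarrow> ('s + 't) pmf option" where
  "union_tr r A B (Inl s) (Inl a) = map_option (map_pmf (r \<circ> Inl)) (tr A s a)"
| "union_tr r A B (Inr t) (Inr b) = map_option (map_pmf (r \<circ> Inr)) (tr B t b)"
| "union_tr r A B _ _ = None"

definition seq_comp :: "('s, 'a) omdp \<Rightarrow> ('t, 'b) omdp \<Rightarrow> ('s + 't, 'a + 'b) omdp" where
  "seq_comp A B =
     \<lparr> states = (states A <+> states B) - (set (out_r A) <+> set (out_l B)),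
       acts = acts A <+> acts B,
       tr = union_tr (redirect A B) A B,
       in_r = map Inl (in_r A),
       in_l = map Inr (in_l B),
       out_r = map Inr (out_r B),
       out_l = map Inl (out_l A) \<rparr>"

definition sum_comp :: "('s, 'a) omdp \<Rightarrow> ('t, 'b) omdp \<Rightarrow> ('s + 't, 'a + 'b) omdp" where
  "sum_comp A B =
     \<lparr> states = states A <+> states B,
       acts = acts A <+> acts B,
       tr = union_tr id A B,
       in_r = map Inl (in_r A) @ map Inr (in_r B),
       in_l = map Inl (in_l A) @ map Inr (in_l B),
       out_r = map Inl (out_r A) @ map Inr (out_r B),
       out_l = map Inl (out_l A) @ map Inr (out_l B) \<rparr>"

text \<open>Isomorphic copy along maps that are injective on the states and on the actions.\<close>

definition relabel :: "('s \<Rightarrow> 't) \<Rightarrow> ('a \<Rightarrow> 'b) \<Rightarrow> ('s, 'a) omdp \<Rightarrow> ('t, 'b) omdp" where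
  "relabel f k A =
     \<lparr> states = f ` states A,
       acts = k ` acts A,
       tr = (\<lambda>x c. if x \<in> f ` states A \<and> c \<in> k ` acts A
                   then map_option (map_pmf f)
                          (tr A (inv_into (states A) f x) (inv_into (acts A) k c))
                   else None),
       in_r = map f (in_r A),
       in_l = map f (in_l A),
       out_r = map f (out_r A),
       out_l = map f (out_l A) \<rparr>"


section \<open>String diagrams\<close>

datatype ('s, 'a) sdiag =
  Const "('s, 'a) omdp"
| Seq "('s, 'a) sdiag" "('s, 'a) sdiag"
| Sum "('s, 'a) sdiag" "('s, 'a) sdiag"

text \<open>
  The semantics of all string diagrams over constants with states in \<open>'s\<close> must live in one type.
  A state of the composite is therefore a pair of the position (in the term) of the component
  occurrence it stems from and the state of that component.  The injection \<open>place\<close> realises the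
  disjoint union of two such state sets in the same type.
\<close>

datatype side = Lft | Rgt

type_synonym 'x placed = "side list \<times> 'x"

definition place :: "'x placed + 'x placed \<Rightarrow> 'x placed" where
  "place = case_sum (apfst (Cons Lft)) (apfst (Cons Rgt))"

definition const_sem :: "('s, 'a) omdp \<Rightarrow> ('s placed, 'a placed) omdp" where
  "const_sem A = relabel (Pair []) (Pair []) A"

definition seq_sem :: "('s placed, 'a placed) omdp \<Rightarrow> ('s placed, 'a placed) omdp \<Rightarrow>
    ('s placed, 'a placed) omdp" where
  "seq_sem A B = relabel place place (seq_comp A B)"

definition sum_sem :: "('s placed, 'a placed) omdp \<Rightarrow> ('s placed, 'a placed) omdp \<Rightarrow>
    ('s placed, 'a placed) omdp" where
  "sum_sem A B = relabel place place (sum_comp A B)"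

primrec sem :: "('s, 'a) sdiag \<Rightarrow> ('s placed, 'a placed) omdp" where
  "sem (Const A) = const_sem A"
| "sem (Seq D E) = seq_sem (sem D) (sem E)"
| "sem (Sum D E) = sum_sem (sem D) (sem E)"

primrec string_diagram :: "('s, 'a) sdiag \<Rightarrow> bool" where
  "string_diagram (Const A) \<longleftrightarrow> is_omdp A"
| "string_diagram (Seq D E) \<longleftrightarrow>
     string_diagram D \<and> string_diagram E \<and> cod_arity (sem D) = dom_arity (sem E)"
| "string_diagram (Sum D E) \<longleftrightarrow> string_diagram D \<and> string_diagram E"

text \<open>Components are pairs (position of the occurrence, oMDP).\<close>

primrec CP :: "('s, 'a) sdiag \<Rightarrow> (side list \<times> ('s, 'a) omdp) set" where
  "CP (Const A) = {([], A)}"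
| "CP (Seq D E) = place ` (CP D <+> CP E)"
| "CP (Sum D E) = place ` (CP D <+> CP E)"

definition I_lc :: "('s, 'a) sdiag \<Rightarrow> 's placed set" where
  "I_lc D = {(p, i). \<exists>A. (p, A) \<in> CP D \<and> i \<in> entrances A}"

text \<open>All pairs \<open>(e, i\<^sub>e)\<close> for the local exits \<open>e\<close> that are not global.\<close>

primrec links :: "('s, 'a) sdiag \<Rightarrow> ('s placed \<times> 's placed) set" where
  "links (Const A) = {}"
| "links (Seq D E) = map_prod (place \<circ> Inl) (place \<circ> Inl) ` links D \<union>
                     map_prod (place \<circ> Inr) (place \<circ> Inr) ` links E \<union>
                     map_prod place place ` set (seq_links (sem D) (sem E))"
| "links (Sum D E) = map_prod (place \<circ> Inl) (place \<circ> Inl) ` links D \<union>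
                     map_prod (place \<circ> Inr) (place \<circ> Inr) ` links E"

definition propagate ::
  "('s, 'a) sdiag \<Rightarrow> ('s placed \<Rightarrow> real) \<Rightarrow> ('s placed \<Rightarrow> real) \<Rightarrow> 's placed \<Rightarrow> real" where
  "propagate D g w e = (if e \<in> exits (sem D) then w e else g (THE i. (e, i) \<in> links D))"


section \<open>Sound approximations and Pareto caches\<close>

definition cube :: "('s, 'a) omdp \<Rightarrow> ('s \<Rightarrow> real) set" where
  "cube A = (exits A \<rightarrow>\<^sub>E {0..1})"

definition achievable :: "('s, 'a) omdp \<Rightarrow> 's \<Rightarrow> ('s \<Rightarrow> real) set" where
  "achievable A i =
     {p \<in> cube A. \<exists>\<sigma>\<in>schedulers A. \<forall>e\<in>exits A. p e \<le> reach_pt A \<sigma> i e}"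

definition down_closed :: "('s, 'a) omdp \<Rightarrow> ('s \<Rightarrow> real) set \<Rightarrow> bool" where
  "down_closed A X \<longleftrightarrow> (\<forall>p\<in>X. \<forall>q\<in>cube A. (\<forall>e\<in>exits A. q e \<le> p e) \<longrightarrow> q \<in> X)"

definition convex_pts :: "('s, 'a) omdp \<Rightarrow> ('s \<Rightarrow> real) set \<Rightarrow> bool" where
  "convex_pts A X \<longleftrightarrow>
     (\<forall>p\<in>X. \<forall>q\<in>X. \<forall>t\<in>{0..1}. (\<lambda>e\<in>exits A. (1 - t) * p e + t * q e) \<in> X)"

definition dc_closure :: "('s, 'a) omdp \<Rightarrow> ('s \<Rightarrow> real) set \<Rightarrow> ('s \<Rightarrow> real) set" where
  "dc_closure A X = (\<lambda>Y. down_closed A Y \<and> convex_pts A Y) hull X"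

type_synonym 's family = "'s \<Rightarrow> ('s \<Rightarrow> real) set"

definition over_approx :: "('s, 'a) omdp \<Rightarrow> 's family \<Rightarrow> bool" where
  "over_approx A U \<longleftrightarrow>
     (\<forall>i\<in>entrances A. U i \<subseteq> cube A \<and> down_closed A (U i) \<and> achievable A i \<subseteq> U i)"

record ('s, 'a) cache =
  lower :: "('s, 'a) omdp \<Rightarrow> 's family"
  upper :: "('s, 'a) omdp \<Rightarrow> 's family"

definition cache_read :: "('s, 'a) omdp \<Rightarrow> ('s \<Rightarrow> real) set \<Rightarrow> ('s \<Rightarrow> real) \<Rightarrow> real" where
  "cache_read A X v = sup0 (wsum A v ` X)"

definition cache_hit ::
  "real \<Rightarrow> ('s, 'a) omdp \<Rightarrow> ('s \<Rightarrow> real) \<Rightarrow> ('s, 'a) cache \<Rightarrow> bool" where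
  "cache_hit \<eta> A v C \<longleftrightarrow>
     (\<forall>i\<in>entrances A. cache_read A (upper C A i) v - cache_read A (lower C A i) v \<le> \<eta>)"

definition local_vi_result ::
  "real \<Rightarrow> ('s, 'a) omdp \<Rightarrow> ('s \<Rightarrow> real) \<Rightarrow>
   ('s \<Rightarrow> real) \<Rightarrow> ('s \<Rightarrow> real) \<Rightarrow> ('s \<Rightarrow> 'a pmf) \<Rightarrow> bool" where
  "local_vi_result \<eta> A v l u \<sigma> \<longleftrightarrow>
     (\<forall>i\<in>entrances A. l i \<in> {0..1} \<and> u i \<in> {0..1} \<and>
        l i \<le> WRPr_max A v i \<and> WRPr_max A v i \<le> u i \<and> u i - l i \<le> \<eta>) \<and>
     \<sigma> \<in> dm_schedulers A"

definition cache_update ::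
  "('s, 'a) omdp \<Rightarrow> ('s \<Rightarrow> real) \<Rightarrow> ('s \<Rightarrow> real) \<Rightarrow> ('s \<Rightarrow> 'a pmf) \<Rightarrow>
   ('s, 'a) cache \<Rightarrow> ('s, 'a) cache" where
  "cache_update A v u \<sigma> C =
     \<lparr> lower = (lower C)(A := \<lambda>i. dc_closure A (lower C A i \<union> {reach_pt A \<sigma> i})),
       upper = (upper C)(A := \<lambda>i. upper C A i \<inter> {p. wsum A v p \<le> u i}) \<rparr>"


section \<open>Compositional value iteration\<close>

definition set_local ::
  "side list \<Rightarrow> ('s, 'a) omdp \<Rightarrow> ('s \<Rightarrow> real) \<Rightarrow> ('s placed \<Rightarrow> real) \<Rightarrow> 's placed \<Rightarrow> real" where
  "set_local p A gA g = (\<lambda>(q, i). if q = p \<and> i \<in> entrances A then gA i else g (q, i))"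

text \<open>
  A round visits every component occurrence once, in any order; later visits in the same round see
  the cache as updated by earlier ones.  Since every occurrence is visited and \<open>h\<close> is only reset
  at the end, no value of the previous \<open>g\<close> survives a round on \<open>I_lc D\<close>.
\<close>

inductive visits :: "real \<Rightarrow> ('s placed \<Rightarrow> real) \<Rightarrow> (side list \<times> ('s, 'a) omdp) list \<Rightarrow>
    ('s, 'a) cache \<times> ('s placed \<Rightarrow> real) \<Rightarrow> ('s, 'a) cache \<times> ('s placed \<Rightarrow> real) \<Rightarrow> bool"
  for \<eta> :: real and h :: "'s placed \<Rightarrow> real" where
  vis_done: "visits \<eta> h [] (C, g) (C, g)"
| vis_hit: "v = (\<lambda>e. h (p, e)) \<Longrightarrow> cache_hit \<eta> A v C \<Longrightarrow>
    visits \<eta> h cs (C, set_local p A (\<lambda>i. cache_read A (lower C A i) v) g) S \<Longrightarrow>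
    visits \<eta> h ((p, A) # cs) (C, g) S"
| vis_miss: "v = (\<lambda>e. h (p, e)) \<Longrightarrow> \<not> cache_hit \<eta> A v C \<Longrightarrow> local_vi_result \<eta> A v l u \<sigma> \<Longrightarrow>
    visits \<eta> h cs (cache_update A v u \<sigma> C, set_local p A l g) S \<Longrightarrow>
    visits \<eta> h ((p, A) # cs) (C, g) S"

type_synonym ('s, 'a) cvi_state =
  "('s, 'a) cache \<times> ('s placed \<Rightarrow> real) \<times> ('s placed \<Rightarrow> real)"

definition cvi_init :: "('s, 'a) sdiag \<Rightarrow> ('s placed \<Rightarrow> real) \<Rightarrow> ('s, 'a) cvi_state" where
  "cvi_init D w =
     (\<lparr> lower = (\<lambda>A i. {}), upper = (\<lambda>A i. cube A) \<rparr>,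
      (\<lambda>i. 0),
      (\<lambda>e. if e \<in> exits (sem D) then w e else 0))"

definition cvi_round :: "('s, 'a) sdiag \<Rightarrow> ('s placed \<Rightarrow> real) \<Rightarrow> real \<Rightarrow>
    ('s, 'a) cvi_state \<Rightarrow> ('s, 'a) cvi_state \<Rightarrow> bool" where
  "cvi_round D w \<eta> = (\<lambda>(C, g, h) (C', g', h').
     (\<exists>cs. distinct cs \<and> set cs = CP D \<and> visits \<eta> h cs (C, g) (C', g')) \<and>
     h' = propagate D g' w)"

text \<open>
  A global stopping criterion is given by its possible verdicts on the current cache and \<open>g\<close>; the
  optimistic one may admit both verdicts in the same state, depending on the candidate picked.
\<close>

type_synonym ('s, 'a) gsc = "('s, 'a) cache \<Rightarrow> ('s placed \<Rightarrow> real) \<Rightarrow> bool \<Rightarrow> bool"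

inductive cvi_reachable :: "('s, 'a) sdiag \<Rightarrow> ('s placed \<Rightarrow> real) \<Rightarrow> real \<Rightarrow> ('s, 'a) gsc \<Rightarrow>
    ('s, 'a) cvi_state \<Rightarrow> bool"
  for D :: "('s, 'a) sdiag" and w :: "'s placed \<Rightarrow> real" and \<eta> :: real
    and gsc :: "('s, 'a) gsc" where
  cvi_start: "cvi_reachable D w \<eta> gsc (cvi_init D w)"
| cvi_step: "cvi_reachable D w \<eta> gsc (C, g, h) \<Longrightarrow> gsc C g False \<Longrightarrow>
    cvi_round D w \<eta> (C, g, h) S \<Longrightarrow> cvi_reachable D w \<eta> gsc S"

definition cvi_terminates_with :: "('s, 'a) sdiag \<Rightarrow> ('s placed \<Rightarrow> real) \<Rightarrow> real \<Rightarrow>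
    ('s, 'a) gsc \<Rightarrow> ('s placed \<Rightarrow> real) \<Rightarrow> bool" where
  "cvi_terminates_with D w \<eta> gsc f \<longleftrightarrow>
     (\<exists>C g h. cvi_reachable D w \<eta> gsc (C, g, h) \<and> gsc C g True \<and>
        f = restrict g (entrances (sem D)))"


section \<open>Global stopping criteria\<close>

text \<open>
  The inserted 0 only matters for a component without actions (hence without schedulers): the
  other values are nonnegative.
\<close>

definition Psi ::
  "('s, 'a) sdiag \<Rightarrow> ('s placed \<Rightarrow> real) \<Rightarrow> ('s placed \<Rightarrow> real) \<Rightarrow> 's placed \<Rightarrow> real" where
  "Psi D w x = (\<lambda>(p, i). let A = (THE A. (p, A) \<in> CP D) in
     Max (insert 0 ((\<lambda>\<sigma>. \<Sum>e\<in>exits A. RPr A \<sigma> e i * propagate D x w (p, e)) ` dm_schedulers A)))"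

definition opt_gsc ::
  "('s, 'a) sdiag \<Rightarrow> ('s placed \<Rightarrow> real) \<Rightarrow> real \<Rightarrow> ('s, 'a) gsc" where
  "opt_gsc D w \<epsilon> C g verdict \<longleftrightarrow>
     (\<exists>x \<in> I_lc D \<rightarrow> {0..1}. (\<forall>i\<in>I_lc D. \<bar>x i - g i\<bar> \<le> \<epsilon>) \<and>
        (verdict \<longleftrightarrow> (\<forall>i\<in>I_lc D. Psi D w x i \<le> x i)))"

type_synonym ('s, 'a) combination =
  "('s, 'a) omdp \<Rightarrow> ('s, 'a) omdp \<Rightarrow> 's family \<Rightarrow> 's family \<Rightarrow> 's family"

definition sound_combinations ::
  "('s placed, 'a placed) combination \<Rightarrow> ('s placed, 'a placed) combination \<Rightarrow> bool" where
  "sound_combinations bseq bsum \<longleftrightarrow>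
     (\<forall>A B U V. is_omdp A \<longrightarrow> is_omdp B \<longrightarrow> over_approx A U \<longrightarrow> over_approx B V \<longrightarrow>
        (cod_arity A = dom_arity B \<longrightarrow> over_approx (seq_sem A B) (bseq A B U V)) \<and>
        over_approx (sum_sem A B) (bsum A B U V))"

text \<open>At a constant, the cached points are transported to the placed copy of the component.\<close>

primrec bottom_up ::
  "('s placed, 'a placed) combination \<Rightarrow> ('s placed, 'a placed) combination \<Rightarrow>
   (('s, 'a) omdp \<Rightarrow> 's family) \<Rightarrow> ('s, 'a) sdiag \<Rightarrow> 's placed family" where
  "bottom_up bseq bsum U (Const A) =
     (\<lambda>i. (\<lambda>p. \<lambda>e\<in>exits (const_sem A). p (snd e)) ` U A (snd i))"
| "bottom_up bseq bsum U (Seq D E) =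
     bseq (sem D) (sem E) (bottom_up bseq bsum U D) (bottom_up bseq bsum U E)"
| "bottom_up bseq bsum U (Sum D E) =
     bsum (sem D) (sem E) (bottom_up bseq bsum U D) (bottom_up bseq bsum U E)"

definition bu_gsc ::
  "('s placed, 'a placed) combination \<Rightarrow> ('s placed, 'a placed) combination \<Rightarrow>
   ('s, 'a) sdiag \<Rightarrow> ('s placed \<Rightarrow> real) \<Rightarrow> real \<Rightarrow> ('s, 'a) gsc" where
  "bu_gsc bseq bsum D w \<epsilon> C g verdict \<longleftrightarrow>
     (verdict \<longleftrightarrow> (\<forall>i\<in>entrances (sem D).
        sup0 (wsum (sem D) w ` bottom_up bseq bsum (upper C) D i) \<le> g i + \<epsilon>))"

end

theory Submission
  imports Defs
begin

text \<open>
  For an open MDP with weighted exits, the optimal values are attained by a deterministic memoryless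
  scheduler (policy improvement) and form the least supersolution of the Bellman inequalities.  The
  transitions of the semantics of a string diagram are those of its components, with removed exits
  replaced by the linked entrances.  Hence the restriction of the global optimal values to a
  component is a supersolution of the component with exit weights propagated along the links, so by
  induction on the rounds \<open>g\<close> never exceeds the global values.  Conversely, a prefixed point of
  \<open>Psi\<close> glues the local optimal values to a global supersolution, which bounds the global values
  from above; this is the optimistic criterion.  For the bottom-up criterion it suffices that cutting
  an over-approximation along \<open>wsum A v p \<le> u i\<close> removes no achievable point.
\<close>

text \<open>Runs may avoid all exits forever, so the Bellman equations can have several solutions
  and do not determine the values. Comparisons between local and global values therefore use
  leastness: finite-horizon values start at 0 and stay below every nonnegative supersolution. Being
  a supersolution is a condition on single transitions, so values pass between a component and the
  whole diagram without restricting schedulers to components or gluing them together. The cache is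
  indexed by oMDPs, not by occurrences, and is read at weights other than those at which its entries
  were computed. Its invariant must hence hold for all weights at once, whereas \<open>g\<close> and
  \<open>h\<close> are compared only with the one global value function for
  \<open>w\<close>.\<close>

section \<open>One-step kernels of a scheduler\<close>

definition kernel :: "('s, 'a, 'z) mdp_scheme \<Rightarrow> ('s \<Rightarrow> 'a pmf) \<Rightarrow> 's \<Rightarrow> 's \<Rightarrow> real" where
  "kernel M \<sigma> s s' = (\<Sum>a\<in>acts M. pmf (\<sigma> s) a * tr_prob M s a s')"

lemma tr_prob_nonneg [simp]: "tr_prob M s a s' \<ge> 0"
  by (simp add: tr_prob_def split: option.split)

lemma kernel_nonneg [simp]: "kernel M \<sigma> s s' \<ge> 0"
  by (simp add: kernel_def sum_nonneg)

text \<open>Translates between finite sums, in which kernels are handled, and expectations, in which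
  \<open>supersol\<close> is stated. An undefined action counts 0, which is why kernels are only
  substochastic.\<close>

lemma sum_tr_prob:
  assumes "is_mdp M"
  shows "(\<Sum>s'\<in>states M. tr_prob M s a s' * f s') =
           (case tr M s a of None \<Rightarrow> 0 | Some d \<Rightarrow> measure_pmf.expectation d f)"
proof (cases "tr M s a")
  case (Some d)
  then have "set_pmf d \<subseteq> states M" "finite (states M)"
    using assms by (auto simp: is_mdp_def)
  then have "measure_pmf.expectation d f = (\<Sum>s'\<in>states M. f s' * pmf d s')"
    by (intro integral_measure_pmf_real) auto
  then show ?thesis
    using Some by (simp add: tr_prob_def mult.commute)
qed (simp add: tr_prob_def)

lemma sum_kernel:
  assumes "is_mdp M"
  shows "(\<Sum>s'\<in>states M. kernel M \<sigma> s s' * f s') =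
           (\<Sum>a\<in>acts M. pmf (\<sigma> s) a * (\<Sum>s'\<in>states M. tr_prob M s a s' * f s'))"
proof -
  have "(\<Sum>s'\<in>states M. kernel M \<sigma> s s' * f s') =
          (\<Sum>s'\<in>states M. \<Sum>a\<in>acts M. pmf (\<sigma> s) a * tr_prob M s a s' * f s')"
    by (simp add: kernel_def sum_distrib_right)
  also have "\<dots> = (\<Sum>a\<in>acts M. \<Sum>s'\<in>states M. pmf (\<sigma> s) a * tr_prob M s a s' * f s')"
    by (rule sum.swap)
  finally show ?thesis
    by (simp add: sum_distrib_left mult.assoc)
qed

lemma sum_tr_prob_le_1:
  assumes "is_mdp M"
  shows "(\<Sum>s'\<in>states M. tr_prob M s a s') \<le> 1"
  using sum_tr_prob[OF assms, of s a "\<lambda>_. 1"] by (simp split: option.splits)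

text \<open>\<open>p\<close> need not be supported in \<open>X\<close>, so its weights there sum to
  at most 1 and the bound relies on \<open>c\<close> being nonnegative. This makes the kernel
  estimates available for arbitrary \<open>\<sigma>\<close>, not only for members of
  \<open>schedulers\<close>.\<close>

lemma sum_pmf_mult_le:
  fixes c :: real
  assumes "finite X" "\<And>a. a \<in> X \<Longrightarrow> f a \<le> c" "c \<ge> 0"
  shows "(\<Sum>a\<in>X. pmf p a * f a) \<le> c"
proof -
  have "(\<Sum>a\<in>X. pmf p a * f a) \<le> (\<Sum>a\<in>X. pmf p a * c)"
    using assms by (intro sum_mono mult_left_mono) auto
  also have "\<dots> = measure_pmf.prob p X * c"
    using assms by (simp add: measure_measure_pmf_finite sum_distrib_right)
  also have "\<dots> \<le> 1 * c"
    using assms by (intro mult_right_mono) auto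
  finally show ?thesis by simp
qed

lemma sum_kernel_le_1:
  assumes "is_mdp M"
  shows "(\<Sum>s'\<in>states M. kernel M \<sigma> s s') \<le> 1"
proof -
  have "(\<Sum>s'\<in>states M. kernel M \<sigma> s s') =
          (\<Sum>a\<in>acts M. pmf (\<sigma> s) a * (\<Sum>s'\<in>states M. tr_prob M s a s'))"
    using sum_kernel[OF assms, of \<sigma> s "\<lambda>_. 1"] by simp
  also have "\<dots> \<le> 1"
    using assms by (intro sum_pmf_mult_le) (auto simp: is_mdp_def sum_tr_prob_le_1)
  finally show ?thesis .
qed

lemma sum_kernel_mono:
  assumes "\<And>s'. s' \<in> states M \<Longrightarrow> f s' \<le> g s'"
  shows "(\<Sum>s'\<in>states M. kernel M \<sigma> s s' * f s') \<le> (\<Sum>s'\<in>states M. kernel M \<sigma> s s' * g s')"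
  using assms by (intro sum_mono mult_left_mono) auto

lemma kernel_return_pmf:
  assumes "finite (acts M)" "a \<in> acts M" "\<sigma> s = return_pmf a"
  shows "kernel M \<sigma> s s' = tr_prob M s a s'"
proof -
  have "kernel M \<sigma> s s' = (\<Sum>b\<in>acts M. if b = a then tr_prob M s a s' else 0)"
    unfolding kernel_def using assms(3) by (intro sum.cong) (auto simp: indicator_def)
  then show ?thesis
    using assms by (simp add: sum.delta)
qed

section \<open>Reachability probabilities as limits\<close>

text \<open>Probability of reaching \<open>t\<close> along a path of at most \<open>n\<close>
  states, not steps; hence horizon 0 yields 0 even at \<open>t\<close>, and the bound on
  \<open>length\<close> in \<open>sum_short_paths\<close> matches without a shift.\<close>

primrec hit :: "('s, 'a, 'z) mdp_scheme \<Rightarrow> ('s \<Rightarrow> 'a pmf) \<Rightarrow> 's \<Rightarrow> nat \<Rightarrow> 's \<Rightarrow> real" where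
  "hit M \<sigma> t 0 s = 0"
| "hit M \<sigma> t (Suc n) s =
     (if s = t then 1 else \<Sum>s'\<in>states M. kernel M \<sigma> s s' * hit M \<sigma> t n s')"

lemma hit_nonneg: "hit M \<sigma> t n s \<ge> 0"
  by (induction n arbitrary: s) (auto intro!: sum_nonneg)

lemma hit_le_1:
  assumes "is_mdp M"
  shows "hit M \<sigma> t n s \<le> 1"
proof (induction n arbitrary: s)
  case (Suc n)
  have "(\<Sum>s'\<in>states M. kernel M \<sigma> s s' * hit M \<sigma> t n s') \<le>
          (\<Sum>s'\<in>states M. kernel M \<sigma> s s' * 1)"
    using Suc by (intro sum_kernel_mono) auto
  then show ?case
    using sum_kernel_le_1[OF assms, of \<sigma> s] by auto
qed auto

lemma path_prob_nonneg: "path_prob M \<sigma> \<pi> \<ge> 0"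
  by (auto simp: path_prob_def intro!: prod_nonneg sum_nonneg)

lemma path_prob_Cons:
  assumes "\<pi> \<noteq> []"
  shows "path_prob M \<sigma> (s # \<pi>) = kernel M \<sigma> s (hd \<pi>) * path_prob M \<sigma> \<pi>"
proof -
  obtain n where "length \<pi> = Suc n"
    using assms by (cases \<pi>) auto
  then show ?thesis
    using assms by (simp add: path_prob_def kernel_def prod.lessThan_Suc_shift hd_conv_nth
        del: prod.lessThan_Suc)
qed

lemma paths_to_self:
  assumes "t \<in> states M"
  shows "paths_to M t t = {[t]}"
proof -
  have "\<pi> = [t]" if "\<pi> \<in> paths_to M t t" for \<pi>
    using that by (cases \<pi>) (auto simp: paths_to_def split: if_splits)
  then show ?thesis
    using assms by (auto simp: paths_to_def)
qed

lemma paths_to_other: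
  assumes "s \<in> states M" "s \<noteq> t"
  shows "paths_to M s t = (\<Union>s'\<in>states M. Cons s ` paths_to M s' t)"
proof (intro set_eqI iffI)
  fix \<pi> assume *: "\<pi> \<in> paths_to M s t"
  then obtain \<rho> where \<rho>: "\<pi> = s # \<rho>" "\<rho> \<noteq> []"
    using assms by (cases \<pi>) (auto simp: paths_to_def split: if_splits)
  then have "\<rho> \<in> paths_to M (hd \<rho>) t" "hd \<rho> \<in> states M"
    using * by (auto simp: paths_to_def)
  then show "\<pi> \<in> (\<Union>s'\<in>states M. Cons s ` paths_to M s' t)"
    using \<rho> by blast
qed (use assms in \<open>auto simp: paths_to_def\<close>)

lemma finite_short_paths:
  assumes "finite (states M)"
  shows "finite {\<pi> \<in> paths_to M s t. length \<pi> \<le> n}"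
  by (rule finite_subset[OF _ finite_lists_length_le[OF assms, of n]])
     (auto simp: paths_to_def)

lemma sum_short_paths:
  assumes "is_mdp M" "t \<in> states M" "s \<in> states M"
  shows "(\<Sum>\<pi> | \<pi> \<in> paths_to M s t \<and> length \<pi> \<le> n. path_prob M \<sigma> \<pi>) = hit M \<sigma> t n s"
  using assms(3)
proof (induction n arbitrary: s)
  case 0
  have "{\<pi> \<in> paths_to M s t. length \<pi> \<le> 0} = {}"
    by (auto simp: paths_to_def)
  then show ?case by (simp only: sum.empty hit.simps)
next
  case (Suc n)
  have fin: "finite (states M)"
    using assms by (simp add: is_mdp_def)
  show ?case
  proof (cases "s = t")
    case True
    then have "{\<pi> \<in> paths_to M s t. length \<pi> \<le> Suc n} = {[t]}"
      using paths_to_self[OF assms(2)] by (simp add: Collect_conv_if)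
    then show ?thesis
      using True by (simp add: path_prob_def)
  next
    case False
    define P where "P s' = {\<pi> \<in> paths_to M s' t. length \<pi> \<le> n}" for s'
    have "{\<pi> \<in> paths_to M s t. length \<pi> \<le> Suc n} = (\<Union>s'\<in>states M. Cons s ` P s')"
      using paths_to_other[OF Suc.prems False] by (auto simp: P_def)
    then have "(\<Sum>\<pi> | \<pi> \<in> paths_to M s t \<and> length \<pi> \<le> Suc n. path_prob M \<sigma> \<pi>) =
        (\<Sum>\<pi>\<in>(\<Union>s'\<in>states M. Cons s ` P s'). path_prob M \<sigma> \<pi>)"
      by simp
    also have "\<dots> = (\<Sum>s'\<in>states M. \<Sum>\<pi>\<in>Cons s ` P s'. path_prob M \<sigma> \<pi>)"
    proof (rule sum.UNION_disjoint[OF fin])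
      show "\<forall>s'\<in>states M. finite (Cons s ` P s')"
        using finite_short_paths[OF fin] by (auto simp: P_def)
    qed (auto simp: P_def paths_to_def)
    also have "\<dots> = (\<Sum>s'\<in>states M. \<Sum>\<pi>\<in>P s'. kernel M \<sigma> s s' * path_prob M \<sigma> \<pi>)"
    proof (rule sum.cong[OF refl])
      fix s' assume "s' \<in> states M"
      have "path_prob M \<sigma> (s # \<pi>) = kernel M \<sigma> s s' * path_prob M \<sigma> \<pi>" if "\<pi> \<in> P s'" for \<pi>
        using that by (auto simp: P_def paths_to_def path_prob_Cons)
      then show "(\<Sum>\<pi>\<in>Cons s ` P s'. path_prob M \<sigma> \<pi>) =
          (\<Sum>\<pi>\<in>P s'. kernel M \<sigma> s s' * path_prob M \<sigma> \<pi>)"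
        by (subst sum.reindex) auto
    qed
    also have "\<dots> = (\<Sum>s'\<in>states M. kernel M \<sigma> s s' * hit M \<sigma> t n s')"
      using Suc.IH by (auto simp: P_def sum_distrib_left[symmetric])
    finally show ?thesis
      using False by simp
  qed
qed

text \<open>\<open>RPr\<close> is an unordered infinite sum. The sets of paths with at most
  \<open>n\<close> states are finite and eventually contain every finite set of paths, so they form
  a sequence along which the sum may be computed; summability follows from \<open>hit\<close> being
  at most 1.\<close>

lemma hit_tendsto_RPr:
  assumes "is_mdp M" "t \<in> states M" "s \<in> states M"
  shows "(\<lambda>n. hit M \<sigma> t n s) \<longlonglongrightarrow> RPr M \<sigma> t s"
proof -
  let ?S = "\<lambda>n. {\<pi> \<in> paths_to M s t. length \<pi> \<le> n}"
  have fin: "finite (?S n)" for n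
    using assms by (intro finite_short_paths) (simp add: is_mdp_def)
  have ev: "\<exists>n. \<forall>m\<ge>n. X \<subseteq> ?S m" if "finite X" "X \<subseteq> paths_to M s t" for X
  proof (intro exI allI impI)
    fix m assume "Max (insert 0 (length ` X)) \<le> m"
    then have "\<forall>\<pi>\<in>X. length \<pi> \<le> m"
      using that by simp
    then show "X \<subseteq> ?S m"
      using that by auto
  qed
  have "path_prob M \<sigma> summable_on paths_to M s t"
  proof (rule nonneg_bdd_above_summable_on)
    show "bdd_above (sum (path_prob M \<sigma>) ` {F. F \<subseteq> paths_to M s t \<and> finite F})"
    proof (rule bdd_aboveI2)
      fix X assume X: "X \<in> {F. F \<subseteq> paths_to M s t \<and> finite F}"
      then obtain n where "X \<subseteq> ?S n"
        using ev[of X] by auto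
      then have "sum (path_prob M \<sigma>) X \<le> sum (path_prob M \<sigma>) (?S n)"
        by (intro sum_mono2 fin) (auto simp: path_prob_nonneg)
      also have "\<dots> \<le> 1"
        using sum_short_paths[OF assms, where n = n and \<sigma> = \<sigma>] hit_le_1[OF assms(1), of \<sigma> t n s] by simp
      finally show "sum (path_prob M \<sigma>) X \<le> 1" .
    qed
  qed (simp add: path_prob_nonneg)
  then have "(sum (path_prob M \<sigma>) \<longlongrightarrow> RPr M \<sigma> t s) (finite_subsets_at_top (paths_to M s t))"
    by (metis RPr_def has_sum_def has_sum_infsum)
  moreover have "filterlim ?S (finite_subsets_at_top (paths_to M s t)) sequentially"
    unfolding filterlim_finite_subsets_at_top
  proof (intro allI impI)
    fix X assume X: "finite X \<and> X \<subseteq> paths_to M s t"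
    then obtain n where "\<forall>m\<ge>n. X \<subseteq> ?S m"
      using ev[of X] by auto
    then show "\<forall>\<^sub>F n in sequentially. finite (?S n) \<and> X \<subseteq> ?S n \<and> ?S n \<subseteq> paths_to M s t"
      using fin by (auto simp: eventually_sequentially)
  qed
  ultimately have "(\<lambda>n. sum (path_prob M \<sigma>) (?S n)) \<longlonglongrightarrow> RPr M \<sigma> t s"
    by (rule filterlim_compose)
  then show ?thesis
    using sum_short_paths[OF assms] by simp
qed

lemma RPr_nonneg:
  assumes "is_mdp M" "t \<in> states M" "s \<in> states M"
  shows "RPr M \<sigma> t s \<ge> 0"
  by (rule LIMSEQ_le_const[OF hit_tendsto_RPr[OF assms]]) (simp add: hit_nonneg)

lemma RPr_self:
  assumes "is_mdp M" "t \<in> states M"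
  shows "RPr M \<sigma> t t = 1"
  by (simp add: RPr_def paths_to_self[OF assms(2)] path_prob_def)

lemma RPr_step:
  assumes "is_mdp M" "t \<in> states M" "s \<in> states M" "s \<noteq> t"
  shows "RPr M \<sigma> t s = (\<Sum>s'\<in>states M. kernel M \<sigma> s s' * RPr M \<sigma> t s')"
proof (rule LIMSEQ_unique)
  show "(\<lambda>n. hit M \<sigma> t (Suc n) s) \<longlonglongrightarrow> RPr M \<sigma> t s"
    using hit_tendsto_RPr[OF assms(1-3)] by (rule LIMSEQ_Suc)
  show "(\<lambda>n. hit M \<sigma> t (Suc n) s) \<longlonglongrightarrow> (\<Sum>s'\<in>states M. kernel M \<sigma> s s' * RPr M \<sigma> t s')"
    using assms by (auto intro!: tendsto_intros hit_tendsto_RPr)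
qed

section \<open>Weighted reachability\<close>

definition weighted :: "('s, 'a) omdp \<Rightarrow> ('s \<Rightarrow> real) \<Rightarrow> ('s \<Rightarrow> 'a pmf) \<Rightarrow> 's \<Rightarrow> real" where
  "weighted A v \<sigma> s = (\<Sum>e\<in>exits A. v e * RPr A \<sigma> e s)"

lemma is_omdpD:
  assumes "is_omdp A"
  shows "is_mdp A" "finite (states A)" "finite (acts A)" "finite (exits A)"
    "exits A \<subseteq> states A" "entrances A \<subseteq> states A" "entrances A \<inter> exits A = {}"
proof -
  show "is_mdp A" "exits A \<subseteq> states A" "entrances A \<subseteq> states A" "entrances A \<inter> exits A = {}"
    using assms unfolding is_omdp_def entrances_def exits_def by auto
  then show "finite (states A)" "finite (acts A)"
    by (simp_all add: is_mdp_def)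
qed (simp add: exits_def)

lemma kernel_exit:
  assumes "is_omdp A" "s \<in> exits A"
  shows "kernel A \<sigma> s s' = 0"
  using assms by (simp add: is_omdp_def kernel_def tr_prob_def)

text \<open>An exit has no outgoing mass, so the step equation gives probability 0 for every other
  exit, and only the one-state path to \<open>s\<close> itself contributes.\<close>

lemma weighted_exit:
  assumes "is_omdp A" "s \<in> exits A"
  shows "weighted A v \<sigma> s = v s"
proof -
  note * = is_omdpD[OF assms(1)]
  have "RPr A \<sigma> e s = (if e = s then 1 else 0)" if "e \<in> exits A" for e
    using that assms * RPr_step[of A e s \<sigma>] RPr_self[of A s \<sigma>]
    by (auto simp: kernel_exit subset_iff)
  then have "weighted A v \<sigma> s = (\<Sum>e\<in>exits A. if e = s then v e else 0)"
    unfolding weighted_def by (intro sum.cong) auto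
  then show ?thesis
    using assms * by (simp add: sum.delta)
qed

lemma weighted_step:
  assumes "is_omdp A" "s \<in> states A - exits A"
  shows "weighted A v \<sigma> s = (\<Sum>s'\<in>states A. kernel A \<sigma> s s' * weighted A v \<sigma> s')"
proof -
  note * = is_omdpD[OF assms(1)]
  have "weighted A v \<sigma> s =
      (\<Sum>e\<in>exits A. \<Sum>s'\<in>states A. v e * (kernel A \<sigma> s s' * RPr A \<sigma> e s'))"
    unfolding weighted_def using assms *
    by (intro sum.cong refl, subst RPr_step) (auto simp: sum_distrib_left)
  also have "\<dots> = (\<Sum>s'\<in>states A. \<Sum>e\<in>exits A. v e * (kernel A \<sigma> s s' * RPr A \<sigma> e s'))"
    by (rule sum.swap)
  finally show ?thesis
    by (simp add: weighted_def sum_distrib_left mult_ac)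
qed

text \<open>The inequality holds at every horizon by induction, with nonnegativity of
  \<open>f\<close> as the base case, and passes to the limit. Together with
  \<open>weighted_step\<close> and \<open>weighted_exit\<close> this identifies the value as the
  least nonnegative solution when the weights are nonnegative.\<close>

lemma weighted_least:
  assumes "is_omdp A" "\<And>s. s \<in> states A \<Longrightarrow> f s \<ge> 0" "\<And>s. s \<in> exits A \<Longrightarrow> v s \<le> f s"
    and "\<And>s. s \<in> states A - exits A \<Longrightarrow> (\<Sum>s'\<in>states A. kernel A \<sigma> s s' * f s') \<le> f s"
    and "s \<in> states A"
  shows "weighted A v \<sigma> s \<le> f s"
proof -
  note * = is_omdpD[OF assms(1)]
  have bound: "(\<Sum>e\<in>exits A. v e * hit A \<sigma> e n s) \<le> f s" if "s \<in> states A" for n s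
    using that
  proof (induction n arbitrary: s)
    case 0
    then show ?case using assms(2) by simp
  next
    case (Suc n)
    show ?case
    proof (cases "s \<in> exits A")
      case True
      then have "(\<Sum>e\<in>exits A. v e * hit A \<sigma> e (Suc n) s) = (\<Sum>e\<in>exits A. if e = s then v e else 0)"
        using assms(1) by (intro sum.cong) (auto simp: kernel_exit)
      then show ?thesis
        using True * assms(3) by (simp add: sum.delta)
    next
      case False
      have "(\<Sum>e\<in>exits A. v e * hit A \<sigma> e (Suc n) s) =
          (\<Sum>e\<in>exits A. \<Sum>s'\<in>states A. v e * (kernel A \<sigma> s s' * hit A \<sigma> e n s'))"
        using False by (intro sum.cong refl) (auto simp: sum_distrib_left)
      also have "\<dots> = (\<Sum>s'\<in>states A. \<Sum>e\<in>exits A. v e * (kernel A \<sigma> s s' * hit A \<sigma> e n s'))"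
        by (rule sum.swap)
      also have "\<dots> = (\<Sum>s'\<in>states A. kernel A \<sigma> s s' * (\<Sum>e\<in>exits A. v e * hit A \<sigma> e n s'))"
        by (simp add: sum_distrib_left mult_ac)
      also have "\<dots> \<le> (\<Sum>s'\<in>states A. kernel A \<sigma> s s' * f s')"
        using Suc.IH by (intro sum_kernel_mono) auto
      also have "\<dots> \<le> f s"
        using assms(4) Suc.prems False by auto
      finally show ?thesis .
    qed
  qed
  have "(\<lambda>n. \<Sum>e\<in>exits A. v e * hit A \<sigma> e n s) \<longlonglongrightarrow> weighted A v \<sigma> s"
    unfolding weighted_def using * assms by (auto intro!: tendsto_intros hit_tendsto_RPr)
  then show ?thesis
    by (rule LIMSEQ_le_const2) (use bound assms in auto)
qed

lemma weighted_nonneg: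
  assumes "is_omdp A" "\<And>e. e \<in> exits A \<Longrightarrow> v e \<ge> 0" "s \<in> states A"
  shows "weighted A v \<sigma> s \<ge> 0"
  unfolding weighted_def
proof (intro sum_nonneg mult_nonneg_nonneg RPr_nonneg)
  show "e \<in> states A" if "e \<in> exits A" for e
    using is_omdpD(5)[OF assms(1)] that by blast
qed (use assms is_omdpD(1) in auto)

text \<open>The constant 1 is a supersolution because kernels are substochastic.\<close>

lemma weighted_le_1:
  assumes "is_omdp A" "\<And>e. e \<in> exits A \<Longrightarrow> v e \<le> 1" "s \<in> states A"
  shows "weighted A v \<sigma> s \<le> 1"
  by (rule weighted_least[OF assms(1)])
     (use assms sum_kernel_le_1[OF is_omdpD(1)[OF assms(1)]] in auto)

text \<open>
  Undiscounted policy improvement: on the set where \<open>weighted A v \<sigma>' - weighted A v \<sigma>\<close> attains a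
  negative minimum, \<open>\<sigma>\<close> and \<open>\<sigma>'\<close> agree and never leave, so that no exit is reached and both
  values vanish.
\<close>

lemma policy_improvement:
  assumes A: "is_omdp A" and v: "\<And>e. e \<in> exits A \<Longrightarrow> v e \<in> {0..1}"
    and s: "s \<in> states A - exits A"
    and better: "weighted A v \<sigma> s <
                  (\<Sum>s'\<in>states A. kernel A (\<sigma>(s := \<mu>)) s s' * weighted A v \<sigma> s')"
    and x: "x \<in> states A"
  shows "weighted A v \<sigma> x \<le> weighted A v (\<sigma>(s := \<mu>)) x"
proof (rule ccontr)
  assume neg: "\<not> ?thesis"
  note * = is_omdpD[OF A]
  let ?\<tau> = "\<sigma>(s := \<mu>)"
  let ?K = "kernel A ?\<tau>"
  define d where "d y = weighted A v ?\<tau> y - weighted A v \<sigma> y" for y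
  define m where "m = Min (d ` states A)"
  have m_le: "m \<le> d y" if "y \<in> states A" for y
    using that *(2) by (simp add: m_def)
  have "m < 0"
    using m_le[OF x] neg by (simp add: d_def)
  have "m \<in> d ` states A"
    unfolding m_def using * x by (intro Min_in) auto
  then obtain z where z: "z \<in> states A" "d z = m"
    by auto
  define Z where "Z = {y \<in> states A. d y = m}"
  have kernel_eq: "kernel A \<sigma> y = ?K y" if "y \<noteq> s" for y
    using that by (simp add: kernel_def fun_eq_iff)
  \<comment> \<open>For a negative \<open>m\<close>, multiplying by a row sum of at most 1 can only
    raise it, so a substochastic average of \<open>d\<close> is still bounded below by
    \<open>m\<close>.\<close>
  have m_le_step: "m \<le> (\<Sum>y'\<in>states A. ?K y y' * d y')" for y
  proof -
    have "m \<le> (\<Sum>y'\<in>states A. ?K y y') * m"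
      using sum_kernel_le_1[OF *(1), of ?\<tau> y] \<open>m < 0\<close>
      by (simp add: mult_le_cancel_right2)
    also have "\<dots> \<le> (\<Sum>y'\<in>states A. ?K y y' * d y')"
      unfolding sum_distrib_right by (intro sum_kernel_mono m_le)
    finally show ?thesis .
  qed
  have Z: "y \<notin> exits A" "y \<noteq> s" "\<And>y'. y' \<in> states A - Z \<Longrightarrow> ?K y y' = 0" if y: "y \<in> Z" for y
  proof -
    have y': "y \<in> states A" "d y = m"
      using y by (auto simp: Z_def)
    show "y \<notin> exits A"
      using y' \<open>m < 0\<close> A by (auto simp: d_def weighted_exit)
    then have step: "weighted A v ?\<tau> y = (\<Sum>y'\<in>states A. ?K y y' * weighted A v ?\<tau> y')"
      using y' A by (intro weighted_step) auto
    show "y \<noteq> s"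
    proof
      assume "y = s"
      \<comment> \<open>At \<open>s\<close> the old value lies strictly below its one-step backup,
        so \<open>d s\<close> strictly exceeds its average under \<open>?K\<close>, which is at
        least \<open>m\<close>.\<close>
      then have "d y > (\<Sum>y'\<in>states A. ?K y y' * d y')"
        using better step by (simp add: d_def right_diff_distrib sum_subtractf)
      then show False
        using m_le_step[of y] y' by simp
    qed
    then have "weighted A v \<sigma> y = (\<Sum>y'\<in>states A. ?K y y' * weighted A v \<sigma> y')"
      using weighted_step[of A y v \<sigma>] kernel_eq y' \<open>y \<notin> exits A\<close> A by auto
    then have "m = (\<Sum>y'\<in>states A. ?K y y' * d y')"
      using step y' by (simp add: d_def right_diff_distrib sum_subtractf)
    \<comment> \<open>After subtracting \<open>m\<close> every summand is nonnegative while the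
      total is at most 0, so the kernel can put mass only where \<open>d\<close> equals
      \<open>m\<close>, that is, inside \<open>Z\<close>.\<close>
    then have "(\<Sum>y'\<in>states A. ?K y y' * (d y' - m)) = m - (\<Sum>y'\<in>states A. ?K y y') * m"
      by (simp add: right_diff_distrib sum_subtractf sum_distrib_right)
    also have "\<dots> \<le> 0"
      using sum_kernel_le_1[OF *(1), of ?\<tau> y] \<open>m < 0\<close> by (simp add: mult_le_cancel_right2)
    finally have "(\<Sum>y'\<in>states A. ?K y y' * (d y' - m)) \<le> 0" .
    moreover have nn: "?K y y' * (d y' - m) \<ge> 0" if "y' \<in> states A" for y'
      using that m_le by simp
    ultimately have "(\<Sum>y'\<in>states A. ?K y y' * (d y' - m)) = 0"
      by (intro antisym sum_nonneg) auto
    then have "\<forall>y'\<in>states A. ?K y y' * (d y' - m) = 0"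
      using sum_nonneg_eq_0_iff[OF *(2), of "\<lambda>y'. ?K y y' * (d y' - m)"] nn by simp
    then show "?K y y' = 0" if "y' \<in> states A - Z" for y'
      using that by (auto simp: Z_def)
  qed
  \<comment> \<open>The indicator of the complement of \<open>Z\<close> is a supersolution for the
    old scheduler, whose kernel agrees with \<open>?K\<close> on \<open>Z\<close>; exits lie outside
    \<open>Z\<close> and weigh at most 1. So the old value at \<open>z\<close> is at most 0, while
    the new one is nonnegative.\<close>
  have "weighted A v \<sigma> z \<le> (if z \<in> Z then 0 else 1)"
  proof (rule weighted_least[OF A])
    fix y assume y: "y \<in> states A - exits A"
    show "(\<Sum>y'\<in>states A. kernel A \<sigma> y y' * (if y' \<in> Z then 0 else 1)) \<le> (if y \<in> Z then 0 else 1)"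
    proof (cases "y \<in> Z")
      case True
      then have "(\<Sum>y'\<in>states A. kernel A \<sigma> y y' * (if y' \<in> Z then 0 else 1)) = 0"
        using Z[of y] kernel_eq by (intro sum.neutral) auto
      then show ?thesis using True by simp
    next
      case False
      have "(\<Sum>y'\<in>states A. kernel A \<sigma> y y' * (if y' \<in> Z then 0 else 1)) \<le>
            (\<Sum>y'\<in>states A. kernel A \<sigma> y y' * 1)"
        by (intro sum_kernel_mono) auto
      then show ?thesis
        using False sum_kernel_le_1[OF *(1), of \<sigma> y] by simp
    qed
  qed (use v Z z in auto)
  then have "d z \<ge> 0"
    using z weighted_nonneg[OF A, of v z ?\<tau>] v by (auto simp: d_def Z_def)
  then show False
    using z \<open>m < 0\<close> by simp
qed

section \<open>Existence of an optimal deterministic memoryless scheduler\<close>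

lemma finite_dm_schedulers: "is_mdp A \<Longrightarrow> finite (dm_schedulers A)"
  by (auto simp: dm_schedulers_def is_mdp_def intro!: finite_PiE)

lemma dm_schedulers_subset: "dm_schedulers A \<subseteq> schedulers A"
  unfolding dm_schedulers_def schedulers_def by (intro PiE_mono) auto

text \<open>There are finitely many DM schedulers, but values of schedulers are only partially
  ordered pointwise. Summing over all states gives a real to maximise; a violated Bellman inequality
  would, by \<open>policy_improvement\<close>, give a scheduler that is nowhere worse and strictly
  better at \<open>s\<close>, hence has a larger sum.\<close>

lemma optimal_dm_scheduler:
  assumes A: "is_omdp A" and v: "\<And>e. e \<in> exits A \<Longrightarrow> v e \<in> {0..1}" and "acts A \<noteq> {}"
  obtains \<sigma> where "\<sigma> \<in> dm_schedulers A"
    "\<And>s a. s \<in> states A - exits A \<Longrightarrow> a \<in> acts A \<Longrightarrow>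
       (\<Sum>s'\<in>states A. tr_prob A s a s' * weighted A v \<sigma> s') \<le> weighted A v \<sigma> s"
proof -
  note * = is_omdpD[OF A]
  define total where "total \<sigma> = (\<Sum>s\<in>states A. weighted A v \<sigma> s)" for \<sigma>
  have fin: "finite (dm_schedulers A)"
    using * by (intro finite_dm_schedulers)
  have "dm_schedulers A \<noteq> {}"
    using assms by (auto simp: dm_schedulers_def PiE_eq_empty_iff)
  then obtain \<sigma> where \<sigma>: "\<sigma> \<in> dm_schedulers A" "\<And>\<tau>. \<tau> \<in> dm_schedulers A \<Longrightarrow> total \<tau> \<le> total \<sigma>"
    using Max_in[of "total ` dm_schedulers A"] Max_ge[of "total ` dm_schedulers A"] fin
    by (metis (no_types, lifting) empty_is_image finite_imageI image_iff imageI)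
  have "(\<Sum>s'\<in>states A. tr_prob A s a s' * weighted A v \<sigma> s') \<le> weighted A v \<sigma> s"
    if s: "s \<in> states A - exits A" and a: "a \<in> acts A" for s a
  proof (rule ccontr)
    define \<tau> where "\<tau> = \<sigma>(s := return_pmf a)"
    assume "\<not> ?thesis"
    then have better: "weighted A v \<sigma> s < (\<Sum>s'\<in>states A. kernel A \<tau> s s' * weighted A v \<sigma> s')"
      using a * kernel_return_pmf[of A a \<tau> s] by (simp add: \<tau>_def)
    then have le: "weighted A v \<sigma> x \<le> weighted A v \<tau> x" if "x \<in> states A" for x
      using policy_improvement[OF A v s _ that] by (simp add: \<tau>_def)
    note better
    also have "(\<Sum>s'\<in>states A. kernel A \<tau> s s' * weighted A v \<sigma> s') \<le>
          (\<Sum>s'\<in>states A. kernel A \<tau> s s' * weighted A v \<tau> s')"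
      using le by (intro sum_kernel_mono)
    also have "\<dots> = weighted A v \<tau> s"
      using weighted_step[OF A s] by simp
    finally have "total \<sigma> < total \<tau>"
      unfolding total_def using le s * by (intro sum_strict_mono_ex1) auto
    moreover have "\<tau> \<in> dm_schedulers A"
      using \<sigma> a s by (auto simp: dm_schedulers_def \<tau>_def PiE_def extensional_def Pi_iff)
    ultimately show False
      using \<sigma>(2)[of \<tau>] by simp
  qed
  then show ?thesis
    using \<sigma>(1) that by blast
qed

section \<open>The maximal value as least Bellman supersolution\<close>

text \<open>Quantifies over transitions instead of schedulers, so that it can be transported along
  maps of states. A state without transitions is constrained only by nonnegativity and, at an exit,
  by its weight.\<close>

definition supersol :: "('s, 'a) omdp \<Rightarrow> ('s \<Rightarrow> real) \<Rightarrow> ('s \<Rightarrow> real) \<Rightarrow> bool" where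
  "supersol A v f \<longleftrightarrow> (\<forall>s\<in>states A. f s \<ge> 0) \<and> (\<forall>e\<in>exits A. v e \<le> f e) \<and>
     (\<forall>s a d. tr A s a = Some d \<longrightarrow> measure_pmf.expectation d f \<le> f s)"

lemma sup0_bounds:
  assumes "\<And>x. x \<in> X \<Longrightarrow> x \<le> b" "b \<ge> 0"
  shows "0 \<le> sup0 X" "sup0 X \<le> b" "\<And>x. x \<in> X \<Longrightarrow> x \<le> sup0 X"
proof -
  have "bdd_above (insert 0 X)"
    using assms by (intro bdd_aboveI[where M = b]) auto
  then show "0 \<le> sup0 X" "\<And>x. x \<in> X \<Longrightarrow> x \<le> sup0 X"
    unfolding sup0_def by (auto intro: cSup_upper)
  show "sup0 X \<le> b"
    unfolding sup0_def using assms by (intro cSup_least) auto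
qed

lemma WRPr_max_eq: "WRPr_max A v s = sup0 ((\<lambda>\<sigma>. weighted A v \<sigma> s) ` schedulers A)"
  by (simp add: WRPr_max_def weighted_def)

lemma weighted_le_supersol:
  assumes "is_omdp A" "supersol A v f" "s \<in> states A"
  shows "weighted A v \<sigma> s \<le> f s"
proof (rule weighted_least[OF assms(1)])
  note * = is_omdpD[OF assms(1)]
  fix s assume s: "s \<in> states A - exits A"
  have "(\<Sum>s'\<in>states A. kernel A \<sigma> s s' * f s') =
      (\<Sum>a\<in>acts A. pmf (\<sigma> s) a * (case tr A s a of None \<Rightarrow> 0 | Some d \<Rightarrow> measure_pmf.expectation d f))"
    by (simp add: sum_kernel[OF *(1)] sum_tr_prob[OF *(1)])
  also have "\<dots> \<le> f s"
    using assms s * by (intro sum_pmf_mult_le) (auto simp: supersol_def split: option.splits)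
  finally show "(\<Sum>s'\<in>states A. kernel A \<sigma> s s' * f s') \<le> f s" .
qed (use assms in \<open>auto simp: supersol_def\<close>)

lemma WRPr_max_le_supersol:
  assumes "is_omdp A" "supersol A v f" "s \<in> states A"
  shows "WRPr_max A v s \<le> f s"
  unfolding WRPr_max_eq
proof (rule sup0_bounds(2))
  show "0 \<le> f s"
    using assms by (simp add: supersol_def)
qed (use weighted_le_supersol[OF assms] in blast)

lemma WRPr_max_bounds:
  assumes "is_omdp A" "\<And>e. e \<in> exits A \<Longrightarrow> v e \<in> {0..1}" "s \<in> states A"
  shows "0 \<le> WRPr_max A v s" "WRPr_max A v s \<le> 1"
    "\<And>\<sigma>. \<sigma> \<in> schedulers A \<Longrightarrow> weighted A v \<sigma> s \<le> WRPr_max A v s"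
proof -
  have le1: "x \<le> 1" if "x \<in> (\<lambda>\<sigma>. weighted A v \<sigma> s) ` schedulers A" for x
    using that assms by (auto intro!: weighted_le_1)
  show "0 \<le> WRPr_max A v s" "WRPr_max A v s \<le> 1"
    unfolding WRPr_max_eq using sup0_bounds(1,2)[OF le1] by auto
  show "weighted A v \<sigma> s \<le> WRPr_max A v s" if "\<sigma> \<in> schedulers A" for \<sigma>
    unfolding WRPr_max_eq using sup0_bounds(3)[OF le1] that by auto
qed

text \<open>
  The case distinction matters for an oMDP without actions: it has no scheduler, hence
  \<open>WRPr_max\<close> is 0 even at the exits.
\<close>

lemma supersol_WRPr_max:
  assumes A: "is_omdp A" and v: "\<And>e. e \<in> exits A \<Longrightarrow> v e \<in> {0..1}"
  shows "supersol A v (\<lambda>s. if s \<in> exits A then v s else WRPr_max A v s)" (is "supersol A v ?V")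
    and "\<And>s. s \<in> states A - exits A \<Longrightarrow>
      WRPr_max A v s \<le> Max (insert 0 ((\<lambda>\<sigma>. weighted A v \<sigma> s) ` dm_schedulers A))"
proof -
  note * = is_omdpD[OF A]
  have nn: "?V s \<ge> 0" if "s \<in> states A" for s
    using WRPr_max_bounds(1)[OF A v] v that by auto
  have "supersol A v ?V \<and> (\<forall>s\<in>states A - exits A.
      WRPr_max A v s \<le> Max (insert 0 ((\<lambda>\<sigma>. weighted A v \<sigma> s) ` dm_schedulers A)))"
  proof (cases "acts A = {}")
    case True
    have "WRPr_max A v s = 0" if "s \<in> states A" for s
    proof -
      have "schedulers A = {}"
        using that True set_pmf_not_empty by (auto simp: schedulers_def PiE_eq_empty_iff)
      then show ?thesis by (simp add: WRPr_max_def sup0_def)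
    qed
    moreover have "tr A s a = None" for s a
      using *(1) True by (cases "tr A s a") (auto simp: is_mdp_def)
    moreover have "finite (dm_schedulers A)"
      using finite_dm_schedulers * by auto
    ultimately show ?thesis
      using nn by (auto simp: supersol_def)
  next
    case False
    obtain \<sigma> where \<sigma>: "\<sigma> \<in> dm_schedulers A"
      "\<And>s a. s \<in> states A - exits A \<Longrightarrow> a \<in> acts A \<Longrightarrow>
         (\<Sum>s'\<in>states A. tr_prob A s a s' * weighted A v \<sigma> s') \<le> weighted A v \<sigma> s"
      using optimal_dm_scheduler[OF A, of v] v False by blast
    let ?W = "weighted A v \<sigma>"
    have W_exit: "?W e = v e" if "e \<in> exits A" for e
      using weighted_exit[OF A that] .
    have W: "supersol A v ?W"
      unfolding supersol_def
    proof (intro conjI ballI allI impI)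
      fix s a d assume d: "tr A s a = Some d"
      then have "s \<in> states A - exits A" "a \<in> acts A"
        using A by (auto simp: is_omdp_def is_mdp_def)
      from \<sigma>(2)[OF this] show "measure_pmf.expectation d ?W \<le> ?W s"
        using sum_tr_prob[OF *(1), of s a ?W] d by simp
    qed (use weighted_nonneg[OF A] v W_exit in auto)
    \<comment> \<open>\<open>?W\<close> is the value of one scheduler, hence at most the supremum,
      and a supersolution, hence at least the supremum.\<close>
    have eq: "WRPr_max A v s = ?W s" if "s \<in> states A" for s
      using WRPr_max_le_supersol[OF A W that] WRPr_max_bounds(3)[OF A v that] \<sigma>(1)
        dm_schedulers_subset by (meson antisym subsetD)
    have "supersol A v ?V"
      unfolding supersol_def
    proof (intro conjI ballI allI impI)
      fix s a d assume d: "tr A s a = Some d"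
      have s: "s \<in> states A - exits A" "set_pmf d \<subseteq> states A"
        using d A by (auto simp: is_omdp_def is_mdp_def)
      then have "measure_pmf.expectation d ?V = measure_pmf.expectation d ?W"
        using eq W_exit by (intro integral_cong_AE) (auto simp: AE_measure_pmf_iff subset_iff)
      then show "measure_pmf.expectation d ?V \<le> ?V s"
        using W d eq s by (auto simp: supersol_def)
    qed (use nn in auto)
    moreover have "?W s \<le> Max (insert 0 ((\<lambda>\<sigma>. weighted A v \<sigma> s) ` dm_schedulers A))" for s
      using \<sigma>(1) finite_dm_schedulers[OF *(1)] by (intro Max_ge) auto
    ultimately show ?thesis
      using eq by auto
  qed
  then show "supersol A v ?V" and "\<And>s. s \<in> states A - exits A \<Longrightarrow>
      WRPr_max A v s \<le> Max (insert 0 ((\<lambda>\<sigma>. weighted A v \<sigma> s) ` dm_schedulers A))"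
    by auto
qed

section \<open>Compositions as open MDPs\<close>

lemma relabel_simps [simp]:
  "states (relabel f k A) = f ` states A" "acts (relabel f k A) = k ` acts A"
  "in_r (relabel f k A) = map f (in_r A)" "in_l (relabel f k A) = map f (in_l A)"
  "out_r (relabel f k A) = map f (out_r A)" "out_l (relabel f k A) = map f (out_l A)"
  "entrances (relabel f k A) = f ` entrances A" "exits (relabel f k A) = f ` exits A"
  by (auto simp: relabel_def entrances_def exits_def)

text \<open>Removes \<open>inv_into\<close> from all later arguments: the existence of a transition
  already places \<open>x\<close> and \<open>a\<close> in the carriers.\<close>

lemma tr_relabel:
  assumes "inj f" "inj k" "is_mdp A"
  shows "tr (relabel f k A) y c = Some d' \<longleftrightarrow>
           (\<exists>x a d. y = f x \<and> c = k a \<and> tr A x a = Some d \<and> d' = map_pmf f d)"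
proof
  assume "tr (relabel f k A) y c = Some d'"
  then obtain x a where "x \<in> states A" "a \<in> acts A" "y = f x" "c = k a"
      and "map_option (map_pmf f)
             (tr A (inv_into (states A) f (f x)) (inv_into (acts A) k (k a))) = Some d'"
    by (auto simp: relabel_def split: if_splits)
  then show "\<exists>x a d. y = f x \<and> c = k a \<and> tr A x a = Some d \<and> d' = map_pmf f d"
    using assms by (auto simp: inv_into_f_f inj_on_subset)
next
  assume "\<exists>x a d. y = f x \<and> c = k a \<and> tr A x a = Some d \<and> d' = map_pmf f d"
  then obtain x a d where *: "y = f x" "c = k a" "tr A x a = Some d" "d' = map_pmf f d"
    by blast
  then have "x \<in> states A" "a \<in> acts A"
    using assms by (auto simp: is_mdp_def)
  then show "tr (relabel f k A) y c = Some d'"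
    using * assms by (auto simp: relabel_def inv_into_f_f inj_on_subset)
qed

lemma is_omdp_relabel:
  assumes "inj f" "inj k" "is_omdp A"
  shows "is_omdp (relabel f k A)"
proof -
  have A: "is_mdp A" "distinct (in_r A @ in_l A @ out_r A @ out_l A)"
    "entrances A \<union> exits A \<subseteq> states A" "\<And>s a. s \<in> exits A \<Longrightarrow> tr A s a = None"
    using assms by (auto simp: is_omdp_def)
  have "is_mdp (relabel f k A)"
    unfolding is_mdp_def tr_relabel[OF assms(1,2) A(1)]
    using A(1) by (auto simp: is_mdp_def; blast)
  moreover have "distinct (map f (in_r A @ in_l A @ out_r A @ out_l A))"
    using A(2) assms(1) inj_on_subset by (subst distinct_map) blast
  moreover have "tr (relabel f k A) (f e) c = None" if "e \<in> exits A" for e c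
  proof (rule ccontr)
    assume "tr (relabel f k A) (f e) c \<noteq> None"
    then obtain d where "tr (relabel f k A) (f e) c = Some d"
      by blast
    then show False
      unfolding tr_relabel[OF assms(1,2) A(1)] using A(4)[OF that] assms(1)
      by (auto simp: inj_eq)
  qed
  ultimately show ?thesis
    unfolding is_omdp_def using A(3) by auto
qed

lemma union_tr_Some:
  "union_tr r A B x c = Some d' \<longleftrightarrow>
     (\<exists>s a d. x = Inl s \<and> c = Inl a \<and> tr A s a = Some d \<and> d' = map_pmf (r \<circ> Inl) d) \<or>
     (\<exists>s a d. x = Inr s \<and> c = Inr a \<and> tr B s a = Some d \<and> d' = map_pmf (r \<circ> Inr) d)"
  by (cases x; cases c) auto

text \<open>Used for \<open>Seq\<close> with \<open>r\<close> the redirection and for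
  \<open>Sum\<close> with \<open>r\<close> the identity; the right-hand side has the shape produced
  by \<open>trans_of_composite\<close>.\<close>

lemma tr_relabel_union:
  "(\<exists>x a d. y = f x \<and> c = k a \<and> union_tr r A B x a = Some d \<and> d' = map_pmf f d) \<longleftrightarrow>
     (\<exists>x a d. y = f (Inl x) \<and> c = k (Inl a) \<and> tr A x a = Some d \<and>
        d' = map_pmf f (map_pmf (r \<circ> Inl) d)) \<or>
     (\<exists>x a d. y = f (Inr x) \<and> c = k (Inr a) \<and> tr B x a = Some d \<and>
        d' = map_pmf f (map_pmf (r \<circ> Inr) d))" (is "?L \<longleftrightarrow> ?R1 \<or> ?R2")
proof
  assume ?L
  then obtain x a d where *: "y = f x" "c = k a" "union_tr r A B x a = Some d" "d' = map_pmf f d"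
    by blast
  from *(3) show "?R1 \<or> ?R2"
    unfolding union_tr_Some using *(1,2,4) by blast
next
  assume "?R1 \<or> ?R2"
  then show ?L
    by (metis union_tr_Some)
qed

locale seq_composable =
  fixes A :: "('s, 'a) omdp" and B :: "('t, 'b) omdp"
  assumes omdp: "is_omdp A" "is_omdp B" and arity: "cod_arity A = dom_arity B"
begin

lemma lengths: "length (out_r A) = length (in_r B)" "length (in_l A) = length (out_l B)"
  using arity by (auto simp: cod_arity_def dom_arity_def)

lemma fst_seq_links: "map fst (seq_links A B) = map Inl (out_r A) @ map Inr (out_l B)"
  using lengths by (simp add: seq_links_def)

lemma snd_seq_links: "map snd (seq_links A B) = map Inr (in_r B) @ map Inl (in_l A)"
  using lengths by (simp add: seq_links_def)

lemma Domain_seq_links: "Domain (set (seq_links A B)) = set (out_r A) <+> set (out_l B)"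
  using arg_cong[OF fst_seq_links, of set] by (auto simp: Domain_fst Plus_def)

lemma Range_seq_links: "Range (set (seq_links A B)) = set (in_l A) <+> set (in_r B)"
  using arg_cong[OF snd_seq_links, of set] by (auto simp: Range_snd Plus_def)

lemma distinct_seq_links: "distinct (map fst (seq_links A B))"
  using omdp unfolding fst_seq_links by (auto simp: is_omdp_def distinct_map)

lemma redirect_link: "(x, y) \<in> set (seq_links A B) \<Longrightarrow> redirect A B x = y"
  using distinct_seq_links by (simp add: redirect_def)

lemma redirect_other: "x \<notin> set (out_r A) <+> set (out_l B) \<Longrightarrow> redirect A B x = x"
  unfolding Domain_seq_links[symmetric] Domain_fst redirect_def
  by (simp add: map_of_eq_None_iff[THEN iffD2])

lemma redirect_cases:
  obtains "(x, redirect A B x) \<in> set (seq_links A B)"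
  | "x \<notin> set (out_r A) <+> set (out_l B)" "redirect A B x = x"
  by (metis DomainE Domain_seq_links redirect_link redirect_other)

lemma entrances_exits:
  "entrances (seq_comp A B) = set (in_r A) <+> set (in_l B)"
  "exits (seq_comp A B) = set (out_l A) <+> set (out_r B)"
  by (auto simp: seq_comp_def entrances_def exits_def)

text \<open>The states removed by the composition are exits, whereas links lead to entrances;
  disjointness of open ends keeps the targets.\<close>

lemma redirect_states:
  assumes "x \<in> states A <+> states B"
  shows "redirect A B x \<in> states (seq_comp A B)"
proof (cases rule: redirect_cases[of x])
  case 1
  then have "redirect A B x \<in> set (in_l A) <+> set (in_r B)"
    using Range_seq_links by blast
  then show ?thesis
    using omdp by (auto simp: seq_comp_def is_omdp_def entrances_def exits_def)
qed (use assms in \<open>auto simp: seq_comp_def\<close>)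

lemma is_omdp_seq_comp: "is_omdp (seq_comp A B)"
proof -
  have mdp: "is_mdp A" "is_mdp B" and no_tr: "\<And>s a. s \<in> exits A \<Longrightarrow> tr A s a = None"
      "\<And>s a. s \<in> exits B \<Longrightarrow> tr B s a = None"
    using omdp by (auto simp: is_omdp_def)
  have "is_mdp (seq_comp A B)"
    unfolding is_mdp_def
  proof (intro conjI allI impI)
    show "finite (states (seq_comp A B))" "finite (acts (seq_comp A B))"
      using mdp by (auto simp: seq_comp_def is_mdp_def)
    fix x c d' assume "tr (seq_comp A B) x c = Some d'"
    then have "union_tr (redirect A B) A B x c = Some d'"
      by (simp add: seq_comp_def)
    then consider s a d where "x = Inl s" "c = Inl a" "tr A s a = Some d"
        "d' = map_pmf (redirect A B \<circ> Inl) d"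
      | s a d where "x = Inr s" "c = Inr a" "tr B s a = Some d"
        "d' = map_pmf (redirect A B \<circ> Inr) d"
      unfolding union_tr_Some by blast
    then have "x \<in> states (seq_comp A B) \<and> c \<in> acts (seq_comp A B) \<and>
        set_pmf d' \<subseteq> states (seq_comp A B)"
    proof cases
      case 1
      then have "s \<in> states A" "a \<in> acts A" "set_pmf d \<subseteq> states A" "s \<notin> exits A"
        using mdp no_tr(1)[of s a] by (auto simp: is_mdp_def)
      moreover from this have "set_pmf d' \<subseteq> states (seq_comp A B)"
        using 1 redirect_states by auto
      ultimately show ?thesis
        using 1 by (auto simp: seq_comp_def exits_def)
    next
      case 2
      then have "s \<in> states B" "a \<in> acts B" "set_pmf d \<subseteq> states B" "s \<notin> exits B"
        using mdp no_tr(2)[of s a] by (auto simp: is_mdp_def)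
      moreover from this have "set_pmf d' \<subseteq> states (seq_comp A B)"
        using 2 redirect_states by auto
      ultimately show ?thesis
        using 2 by (auto simp: seq_comp_def exits_def)
    qed
    then show "x \<in> states (seq_comp A B)" "c \<in> acts (seq_comp A B)"
      "set_pmf d' \<subseteq> states (seq_comp A B)"
      by auto
  qed
  moreover have "tr (seq_comp A B) x c = None" if "x \<in> exits (seq_comp A B)" for x c
    using that no_tr unfolding entrances_exits
    by (cases x; cases c) (auto simp: seq_comp_def exits_def)
  moreover have "distinct (in_r (seq_comp A B) @ in_l (seq_comp A B) @
      out_r (seq_comp A B) @ out_l (seq_comp A B))"
    using omdp by (auto simp: is_omdp_def seq_comp_def distinct_map)
  moreover have "entrances (seq_comp A B) \<union> exits (seq_comp A B) \<subseteq> states (seq_comp A B)"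
    unfolding entrances_exits using omdp
    by (auto simp: is_omdp_def seq_comp_def entrances_def exits_def)
  ultimately show ?thesis
    unfolding is_omdp_def by blast
qed

end

lemma entrances_sum_comp: "entrances (sum_comp A B) = entrances A <+> entrances B"
  and exits_sum_comp: "exits (sum_comp A B) = exits A <+> exits B"
  by (auto simp: sum_comp_def entrances_def exits_def)

lemma is_omdp_sum_comp:
  assumes "is_omdp A" "is_omdp B"
  shows "is_omdp (sum_comp A B)"
proof -
  have mdp: "is_mdp A" "is_mdp B" and no_tr: "\<And>s a. s \<in> exits A \<Longrightarrow> tr A s a = None"
      "\<And>s a. s \<in> exits B \<Longrightarrow> tr B s a = None"
    using assms by (auto simp: is_omdp_def)
  have "is_mdp (sum_comp A B)"
    using mdp unfolding is_mdp_def sum_comp_def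
    by (simp add: union_tr_Some) fastforce
  moreover have "tr (sum_comp A B) x c = None" if "x \<in> exits (sum_comp A B)" for x c
    using that no_tr unfolding exits_sum_comp
    by (cases x; cases c) (auto simp: sum_comp_def)
  moreover have "distinct (in_r (sum_comp A B) @ in_l (sum_comp A B) @
      out_r (sum_comp A B) @ out_l (sum_comp A B))"
    using assms by (auto simp: is_omdp_def sum_comp_def distinct_map)
  moreover have "entrances (sum_comp A B) \<union> exits (sum_comp A B) \<subseteq> states (sum_comp A B)"
    unfolding exits_sum_comp entrances_sum_comp using assms
    by (auto simp: is_omdp_def sum_comp_def)
  ultimately show ?thesis
    unfolding is_omdp_def by blast
qed

section \<open>The global MDP in terms of the components\<close>

lemma place_simps [simp]:
  "place (Inl (p, x)) = (Lft # p, x)" "place (Inr (p, x)) = (Rgt # p, x)"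
  by (simp_all add: place_def)

lemma inj_place [simp]: "inj place"
  by (auto simp: place_def inj_def split: sum.splits)

lemma place_eq_iff [simp]: "place x = place y \<longleftrightarrow> x = y"
  by (simp add: inj_eq)

lemma is_omdp_seq_sem:
  "is_omdp A \<Longrightarrow> is_omdp B \<Longrightarrow> cod_arity A = dom_arity B \<Longrightarrow> is_omdp (seq_sem A B)"
  unfolding seq_sem_def
  by (intro is_omdp_relabel inj_place seq_composable.is_omdp_seq_comp seq_composable.intro)

lemma is_omdp_sum_sem: "is_omdp A \<Longrightarrow> is_omdp B \<Longrightarrow> is_omdp (sum_sem A B)"
  unfolding sum_sem_def by (intro is_omdp_relabel inj_place is_omdp_sum_comp)

lemma is_omdp_const_sem: "is_omdp A \<Longrightarrow> is_omdp (const_sem A)"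
  unfolding const_sem_def by (intro is_omdp_relabel) (auto simp: inj_def)

lemma is_omdp_sem: "string_diagram D \<Longrightarrow> is_omdp (sem D)"
  by (induction D) (auto intro: is_omdp_const_sem is_omdp_seq_sem is_omdp_sum_sem)

lemma CP_place:
  "(q, A) \<in> place ` (X <+> Y) \<longleftrightarrow>
     (\<exists>p. q = Lft # p \<and> (p, A) \<in> X) \<or> (\<exists>p. q = Rgt # p \<and> (p, A) \<in> Y)"
  by (force simp: image_iff Bex_def)

lemma is_omdp_CP: "string_diagram D \<Longrightarrow> (p, A) \<in> CP D \<Longrightarrow> is_omdp A"
  by (induction D arbitrary: p) (auto simp: CP_place)

lemma CP_unique: "(p, A) \<in> CP D \<Longrightarrow> (p, B) \<in> CP D \<Longrightarrow> A = B"
  by (induction D arbitrary: p) (auto simp: CP_place)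

section \<open>Local open ends and the links between them\<close>

text \<open>Parametric in \<open>X\<close> so that the same lemmas serve local entrances, local
  exits and local states.\<close>

definition local_of :: "(('s, 'a) omdp \<Rightarrow> 's set) \<Rightarrow> ('s, 'a) sdiag \<Rightarrow> 's placed set" where
  "local_of X D = {(p, x). \<exists>A. (p, A) \<in> CP D \<and> x \<in> X A}"

lemma local_of_simps [simp]:
  "local_of X (Const A) = Pair [] ` X A"
  "local_of X (Seq D E) = place ` (local_of X D <+> local_of X E)"
  "local_of X (Sum D E) = place ` (local_of X D <+> local_of X E)"
  by (auto simp: local_of_def CP_place)

lemma I_lc_eq: "I_lc D = local_of entrances D"
  by (simp add: I_lc_def local_of_def)

lemma local_of_mono:
  assumes "string_diagram D" "\<And>A. is_omdp A \<Longrightarrow> X A \<subseteq> Y A"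
  shows "local_of X D \<subseteq> local_of Y D"
  using assms is_omdp_CP[OF assms(1)] by (fastforce simp: local_of_def)

lemma local_of_disjoint:
  assumes "string_diagram D" "\<And>A. is_omdp A \<Longrightarrow> X A \<inter> Y A = {}"
  shows "local_of X D \<inter> local_of Y D = {}"
  using assms is_omdp_CP[OF assms(1)] CP_unique by (fastforce simp: local_of_def)

lemma entrances_sem: "string_diagram D \<Longrightarrow> entrances (sem D) \<subseteq> local_of entrances D"
proof (induction D)
  case (Seq D E)
  then interpret seq_composable "sem D" "sem E"
    by unfold_locales (auto simp: is_omdp_sem)
  show ?case
    using Seq entrances_def[of "sem D"] entrances_def[of "sem E"]
    by (auto simp: seq_sem_def entrances_exits)
next
  case (Sum D E)
  then show ?case
    by (auto simp: sum_sem_def entrances_sum_comp)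
qed (auto simp: const_sem_def)

lemma Domain_map_prod: "Domain (map_prod f g ` R) = f ` Domain R"
  by force

lemma Range_map_prod: "Range (map_prod f g ` R) = g ` Range R"
  by force

lemma Domain_links_simps:
  "string_diagram (Seq D E) \<Longrightarrow> Domain (links (Seq D E)) =
     place ` ((Domain (links D) \<union> set (out_r (sem D))) <+> (Domain (links E) \<union> set (out_l (sem E))))"
  "Domain (links (Sum D E)) = place ` (Domain (links D) <+> Domain (links E))"
proof -
  assume "string_diagram (Seq D E)"
  then interpret seq_composable "sem D" "sem E"
    by unfold_locales (auto simp: is_omdp_sem)
  show "Domain (links (Seq D E)) = place ` ((Domain (links D) \<union> set (out_r (sem D))) <+>
      (Domain (links E) \<union> set (out_l (sem E))))"
    by (simp add: Domain_Un_eq Domain_map_prod Domain_seq_links Plus_def image_Un image_comp Un_ac)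
next
  show "Domain (links (Sum D E)) = place ` (Domain (links D) <+> Domain (links E))"
    by (simp add: Domain_Un_eq Domain_map_prod Plus_def image_Un image_comp)
qed

lemma Range_links: "string_diagram D \<Longrightarrow> Range (links D) \<subseteq> local_of entrances D"
proof (induction D)
  case (Seq D E)
  then interpret seq_composable "sem D" "sem E"
    by unfold_locales (auto simp: is_omdp_sem)
  have "set (in_l (sem D)) \<subseteq> local_of entrances D" "set (in_r (sem E)) \<subseteq> local_of entrances E"
    using entrances_sem[of D] entrances_sem[of E] Seq.prems by (auto simp: entrances_def)
  then show ?case
    using Seq by (auto simp: Range_Un_eq Range_map_prod Range_seq_links image_comp[symmetric])
next
  case (Sum D E)
  then show ?case
    by (auto simp: Range_Un_eq Range_map_prod image_comp[symmetric])
qed simp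

lemma place_Plus_simps:
  "place ` (A <+> B) \<inter> place ` (C <+> D) = place ` ((A \<inter> C) <+> (B \<inter> D))"
  "place ` (A <+> B) \<union> place ` (C <+> D) = place ` ((A \<union> C) <+> (B \<union> D))"
  by (auto simp: Plus_def)

text \<open>The linked and the global exits partition the local ones. A sequential composition moves
  the exits on its inner boundary from the second class to the first, and disjointness of
  \<open>out_r\<close> and \<open>out_l\<close> keeps the classes apart.\<close>

lemma exits_sem:
  assumes "string_diagram D"
  shows "Domain (links D) \<union> exits (sem D) = local_of exits D"
    and "Domain (links D) \<inter> exits (sem D) = {}"
proof -
  have "Domain (links D) \<union> exits (sem D) = local_of exits D \<and>
      Domain (links D) \<inter> exits (sem D) = {}"
    using assms
  proof (induction D)
    case (Seq D E)
    then interpret seq_composable "sem D" "sem E"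
      by unfold_locales (auto simp: is_omdp_sem)
    have "set (out_r (sem D)) \<inter> set (out_l (sem D)) = {}"
        "set (out_r (sem E)) \<inter> set (out_l (sem E)) = {}"
      using omdp by (auto simp: is_omdp_def)
    then have "(Domain (links D) \<union> set (out_r (sem D))) \<inter> set (out_l (sem D)) = {}"
        "(Domain (links E) \<union> set (out_l (sem E))) \<inter> set (out_r (sem E)) = {}"
        "Domain (links D) \<union> set (out_r (sem D)) \<union> set (out_l (sem D)) = local_of exits D"
        "Domain (links E) \<union> set (out_l (sem E)) \<union> set (out_r (sem E)) = local_of exits E"
      using Seq exits_def[of "sem D"] exits_def[of "sem E"] by auto
    then show ?case
      using Domain_links_simps(1)[OF Seq.prems]
      by (simp add: seq_sem_def entrances_exits place_Plus_simps del: links.simps)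
  next
    case (Sum D E)
    then show ?case
      by (simp add: Domain_links_simps sum_sem_def exits_sum_comp place_Plus_simps del: links.simps)
  qed (simp add: const_sem_def)
  then show "Domain (links D) \<union> exits (sem D) = local_of exits D"
    and "Domain (links D) \<inter> exits (sem D) = {}"
    by auto
qed

lemma states_sem: "string_diagram D \<Longrightarrow> states (sem D) = local_of states D - Domain (links D)"
proof (induction D)
  case (Seq D E)
  then show ?case
    unfolding Domain_links_simps(1)[OF Seq.prems]
    by (auto simp: seq_sem_def seq_comp_def simp del: links.simps)
next
  case (Sum D E)
  then show ?case
    unfolding Domain_links_simps(2)
    by (auto simp: sum_sem_def sum_comp_def simp del: links.simps)
qed (auto simp: const_sem_def)

lemma single_valued_map_prod:
  assumes "single_valued R" "inj f"
  shows "single_valued (map_prod f g ` R)"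
  using assms by (auto simp: single_valued_def inj_def)

lemma single_valued_Un:
  assumes "single_valued R" "single_valued S" "Domain R \<inter> Domain S = {}"
  shows "single_valued (R \<union> S)"
  using assms unfolding single_valued_def by blast

text \<open>An exit that receives a link in an outer composition was still global inside, so by
  \<open>exits_sem\<close> it had no link before. This justifies the definite description in
  \<open>propagate\<close>.\<close>

lemma single_valued_links: "string_diagram D \<Longrightarrow> single_valued (links D)"
proof (induction D)
  case (Seq D E)
  then interpret seq_composable "sem D" "sem E"
    by unfold_locales (auto simp: is_omdp_sem)
  have "set (out_r (sem D)) \<inter> Domain (links D) = {}" "set (out_l (sem E)) \<inter> Domain (links E) = {}"
    using exits_sem(2)[of D] exits_sem(2)[of E] Seq.prems by (auto simp: exits_def)
  moreover have "single_valued (set (seq_links (sem D) (sem E)))"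
    using redirect_link unfolding single_valued_def by metis
  ultimately show ?case
    using Seq unfolding links.simps
    by (intro single_valued_Un single_valued_map_prod inj_compose inj_place)
       (auto simp: Domain_Un_eq Domain_map_prod Domain_seq_links)
next
  case (Sum D E)
  then show ?case
    unfolding links.simps
    by (intro single_valued_Un single_valued_map_prod inj_compose inj_place)
       (auto simp: Domain_map_prod)
qed simp

text \<open>The partial map \<open>e \<mapsto> i_e\<close> extended by the identity: it sends each
  local state to the state of \<open>sem D\<close> that stands for it. Being total, it can be pushed
  through distributions.\<close>

definition link :: "('s, 'a) sdiag \<Rightarrow> 's placed \<Rightarrow> 's placed" where
  "link D e = (if e \<in> Domain (links D) then THE i. (e, i) \<in> links D else e)"

lemma link_eq: "string_diagram D \<Longrightarrow> (e, i) \<in> links D \<Longrightarrow> link D e = i"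
  using single_valued_links[of D] unfolding link_def
  by (metis DomainI single_valuedD the_equality)

lemma link_other: "e \<notin> Domain (links D) \<Longrightarrow> link D e = e"
  by (simp add: link_def)

lemma link_cases:
  assumes "string_diagram D" "e \<in> local_of states D"
  obtains "(e, link D e) \<in> links D" "link D e \<in> local_of entrances D"
  | "e \<notin> Domain (links D)" "link D e = e" "e \<in> states (sem D)"
proof (cases "e \<in> Domain (links D)")
  case True
  then have "(e, link D e) \<in> links D"
    using link_eq[OF assms(1)] by (metis DomainE)
  then show ?thesis
    using Range_links[OF assms(1)] that(1) by blast
next
  case False
  then show ?thesis
    using that(2)[OF False link_other[OF False]] assms states_sem by blast
qed

text \<open>A redirected transition lands in a local entrance. Since entrances survive and are never
  linked themselves, redirections do not chain.\<close>

lemma local_entrance_not_exit: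
  assumes "string_diagram D" "i \<in> local_of entrances D"
  shows "i \<notin> exits (sem D)" "i \<notin> Domain (links D)" "i \<in> states (sem D)"
proof -
  have "local_of entrances D \<inter> local_of exits D = {}"
    using assms(1) by (rule local_of_disjoint) (rule is_omdpD(7))
  then show "i \<notin> exits (sem D)" "i \<notin> Domain (links D)"
    using assms exits_sem(1)[OF assms(1)] by auto
  moreover have "local_of entrances D \<subseteq> local_of states D"
    using assms(1) by (rule local_of_mono) (rule is_omdpD(6))
  ultimately show "i \<in> states (sem D)"
    using states_sem assms by auto
qed

lemma link_states: "string_diagram D \<Longrightarrow> e \<in> local_of states D \<Longrightarrow> link D e \<in> states (sem D)"
  by (rule link_cases[of D e]) (auto intro: local_entrance_not_exit)

text \<open>At most one of the two maps moves a state: an inner link ends in an entrance, which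
  \<open>redirect\<close> fixes, and a state without an inner link is left to the outer
  composition.\<close>

lemma link_Seq:
  assumes D: "string_diagram (Seq D E)"
  shows "e \<in> local_of states D \<Longrightarrow>
      link (Seq D E) (place (Inl e)) = place (redirect (sem D) (sem E) (Inl (link D e)))"
    and "e' \<in> local_of states E \<Longrightarrow>
      link (Seq D E) (place (Inr e')) = place (redirect (sem D) (sem E) (Inr (link E e')))"
proof -
  from D interpret seq_composable "sem D" "sem E"
    by unfold_locales (auto simp: is_omdp_sem)
  have sd: "string_diagram D" "string_diagram E"
    using D by auto
  have seq_link: "link (Seq D E) (place x) = place (redirect (sem D) (sem E) x)"
    if "x \<notin> Domain (links D) <+> Domain (links E)" for x
  proof (cases rule: redirect_cases[of x])
    case 1
    then have "(place x, place (redirect (sem D) (sem E) x)) \<in> links (Seq D E)"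
      unfolding links.simps by (intro UnI2 image_eqI[OF _ 1]) simp
    then show ?thesis
      by (rule link_eq[OF D])
  next
    case 2
    then have "place x \<notin> Domain (links (Seq D E))"
      using that unfolding Domain_links_simps(1)[OF D] inj_image_mem_iff[OF inj_place] by auto
    then show ?thesis
      using 2 by (simp add: link_other)
  qed
  show "link (Seq D E) (place (Inl e)) = place (redirect (sem D) (sem E) (Inl (link D e)))"
    if e: "e \<in> local_of states D"
  proof (cases rule: link_cases[OF sd(1) e])
    case 1
    have "(place (Inl e), place (Inl (link D e))) \<in> links (Seq D E)"
      unfolding links.simps by (intro UnI1 image_eqI[OF _ 1(1)]) simp
    then have "link (Seq D E) (place (Inl e)) = place (Inl (link D e))"
      by (rule link_eq[OF D])
    moreover have "redirect (sem D) (sem E) (Inl (link D e)) = Inl (link D e)"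
      using local_entrance_not_exit(1)[OF sd(1) 1(2)]
      by (intro redirect_other) (auto simp: exits_def)
    ultimately show ?thesis by simp
  next
    case 2
    then have "Inl e \<notin> Domain (links D) <+> Domain (links E)"
      by auto
    then show ?thesis
      using 2 by (simp add: seq_link)
  qed
  show "link (Seq D E) (place (Inr e')) = place (redirect (sem D) (sem E) (Inr (link E e')))"
    if e': "e' \<in> local_of states E"
  proof (cases rule: link_cases[OF sd(2) e'])
    case 1
    have "(place (Inr e'), place (Inr (link E e'))) \<in> links (Seq D E)"
      unfolding links.simps by (intro UnI1[OF UnI2] image_eqI[OF _ 1(1)]) simp
    then have "link (Seq D E) (place (Inr e')) = place (Inr (link E e'))"
      by (rule link_eq[OF D])
    moreover have "redirect (sem D) (sem E) (Inr (link E e')) = Inr (link E e')"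
      using local_entrance_not_exit(1)[OF sd(2) 1(2)]
      by (intro redirect_other) (auto simp: exits_def)
    ultimately show ?thesis by simp
  next
    case 2
    then have "Inr e' \<notin> Domain (links D) <+> Domain (links E)"
      by auto
    then show ?thesis
      using 2 by (simp add: seq_link)
  qed
qed

lemma link_Sum:
  assumes D: "string_diagram (Sum D E)"
  shows "link (Sum D E) (place (Inl e)) = place (Inl (link D e))"
    and "link (Sum D E) (place (Inr e')) = place (Inr (link E e'))"
proof -
  show "link (Sum D E) (place (Inl e)) = place (Inl (link D e))"
  proof (cases "e \<in> Domain (links D)")
    case True
    then have "(e, link D e) \<in> links D"
      using D link_eq[of D] by (metis DomainE string_diagram.simps(3))
    then have "(place (Inl e), place (Inl (link D e))) \<in> links (Sum D E)"
      unfolding links.simps by (intro UnI1 image_eqI) simp_all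
    then show ?thesis
      by (rule link_eq[OF D])
  next
    case False
    then have "place (Inl e) \<notin> Domain (links (Sum D E))"
      unfolding Domain_links_simps(2) inj_image_mem_iff[OF inj_place] by auto
    then show ?thesis
      using False by (simp add: link_other)
  qed
  show "link (Sum D E) (place (Inr e')) = place (Inr (link E e'))"
  proof (cases "e' \<in> Domain (links E)")
    case True
    then have "(e', link E e') \<in> links E"
      using D link_eq[of E] by (metis DomainE string_diagram.simps(3))
    then have "(place (Inr e'), place (Inr (link E e'))) \<in> links (Sum D E)"
      unfolding links.simps by (intro UnI2 image_eqI) simp_all
    then show ?thesis
      by (rule link_eq[OF D])
  next
    case False
    then have "place (Inr e') \<notin> Domain (links (Sum D E))"
      unfolding Domain_links_simps(2) inj_image_mem_iff[OF inj_place] by auto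
    then show ?thesis
      using False by (simp add: link_other)
  qed
qed

section \<open>Transitions of the semantics, component by component\<close>

text \<open>A flat description of the transitions of \<open>sem D\<close>. Once
  \<open>tr_sem\<close> has identified the two, Bellman inequalities can be checked one component at
  a time, without induction on the diagram.\<close>

definition trans_of :: "('s, 'a) sdiag \<Rightarrow> ('s placed \<times> 'a placed \<times> 's placed pmf) set" where
  "trans_of D = {((p, s), (p, a), map_pmf (\<lambda>s'. link D (p, s')) d) | p s a d.
     \<exists>A. (p, A) \<in> CP D \<and> tr A s a = Some d}"

lemma trans_ofE:
  assumes "(y, c, d') \<in> trans_of D"
  obtains p s a A d where "(p, A) \<in> CP D" "tr A s a = Some d" "y = (p, s)" "c = (p, a)"
    "d' = map_pmf (\<lambda>s'. link D (p, s')) d"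
  using assms by (auto simp: trans_of_def)

text \<open>Abstracts from the kind of composition: all that differs between \<open>Seq\<close> and
  \<open>Sum\<close> is the map \<open>r\<close> applied after the inner links.\<close>

lemma trans_of_composite:
  assumes "string_diagram D" "string_diagram E"
    and CP: "CP F = place ` (CP D <+> CP E)"
    and l: "\<And>e. e \<in> local_of states D \<Longrightarrow> link F (place (Inl e)) = place (r (Inl (link D e)))"
    and r: "\<And>e. e \<in> local_of states E \<Longrightarrow> link F (place (Inr e)) = place (r (Inr (link E e)))"
  shows "(y, c, d') \<in> trans_of F \<longleftrightarrow>
    (\<exists>x b d. y = place (Inl x) \<and> c = place (Inl b) \<and> (x, b, d) \<in> trans_of D \<and>
       d' = map_pmf place (map_pmf (r \<circ> Inl) d)) \<or>
    (\<exists>x b d. y = place (Inr x) \<and> c = place (Inr b) \<and> (x, b, d) \<in> trans_of E \<and>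
       d' = map_pmf place (map_pmf (r \<circ> Inr) d))" (is "?L \<longleftrightarrow> ?R1 \<or> ?R2")
proof -
  have D: "map_pmf (\<lambda>s'. link F (Lft # p, s')) d =
      map_pmf place (map_pmf (r \<circ> Inl) (map_pmf (\<lambda>s'. link D (p, s')) d))"
    if "(p, A) \<in> CP D" "tr A s a = Some d" for p A s a d
  proof -
    \<comment> \<open>The hypothesis on \<open>link F\<close> covers only local states, so the two
      images of \<open>d\<close> can be compared only on its support.\<close>
    have "set_pmf d \<subseteq> states A"
      using is_omdpD(1)[OF is_omdp_CP[OF assms(1) that(1)]] that by (auto simp: is_mdp_def)
    then have "\<forall>s'\<in>set_pmf d. (p, s') \<in> local_of states D"
      using that by (auto simp: local_of_def)
    then show ?thesis
      using l by (auto simp: pmf.map_comp o_def intro!: map_pmf_cong simp flip: place_simps)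
  qed
  have E: "map_pmf (\<lambda>s'. link F (Rgt # p, s')) d =
      map_pmf place (map_pmf (r \<circ> Inr) (map_pmf (\<lambda>s'. link E (p, s')) d))"
    if "(p, A) \<in> CP E" "tr A s a = Some d" for p A s a d
  proof -
    have "set_pmf d \<subseteq> states A"
      using is_omdpD(1)[OF is_omdp_CP[OF assms(2) that(1)]] that by (auto simp: is_mdp_def)
    then have "\<forall>s'\<in>set_pmf d. (p, s') \<in> local_of states E"
      using that by (auto simp: local_of_def)
    then show ?thesis
      using r by (auto simp: pmf.map_comp o_def intro!: map_pmf_cong simp flip: place_simps)
  qed
  show ?thesis
  proof
    assume ?L
    then obtain q A s a d where *: "(q, A) \<in> CP F" "tr A s a = Some d" "y = (q, s)" "c = (q, a)"
        "d' = map_pmf (\<lambda>s'. link F (q, s')) d"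
      by (auto simp: trans_of_def)
    from *(1) consider p where "q = Lft # p" "(p, A) \<in> CP D" | p where "q = Rgt # p" "(p, A) \<in> CP E"
      unfolding CP CP_place by blast
    then show "?R1 \<or> ?R2"
    proof cases
      case 1
      then have "((p, s), (p, a), map_pmf (\<lambda>s'. link D (p, s')) d) \<in> trans_of D"
        using *(2) by (auto simp: trans_of_def)
      then show ?thesis
        using * 1 D[OF 1(2) *(2)] by (metis place_simps(1))
    next
      case 2
      then have "((p, s), (p, a), map_pmf (\<lambda>s'. link E (p, s')) d) \<in> trans_of E"
        using *(2) by (auto simp: trans_of_def)
      then show ?thesis
        using * 2 E[OF 2(2) *(2)] by (metis place_simps(2))
    qed
  next
    assume "?R1 \<or> ?R2"
    then show ?L
    proof
      assume ?R1
      then obtain p s a A d where *: "(p, A) \<in> CP D" "tr A s a = Some d"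
          "y = (Lft # p, s)" "c = (Lft # p, a)"
          "d' = map_pmf place (map_pmf (r \<circ> Inl) (map_pmf (\<lambda>s'. link D (p, s')) d))"
        by (auto simp: trans_of_def)
      then have "(Lft # p, A) \<in> CP F" "d' = map_pmf (\<lambda>s'. link F (Lft # p, s')) d"
        using D[OF *(1,2)] by (auto simp: CP CP_place)
      then show ?L
        using * by (auto simp: trans_of_def)
    next
      assume ?R2
      then obtain p s a A d where *: "(p, A) \<in> CP E" "tr A s a = Some d"
          "y = (Rgt # p, s)" "c = (Rgt # p, a)"
          "d' = map_pmf place (map_pmf (r \<circ> Inr) (map_pmf (\<lambda>s'. link E (p, s')) d))"
        by (auto simp: trans_of_def)
      then have "(Rgt # p, A) \<in> CP F" "d' = map_pmf (\<lambda>s'. link F (Rgt # p, s')) d"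
        using E[OF *(1,2)] by (auto simp: CP CP_place)
      then show ?L
        using * by (auto simp: trans_of_def)
    qed
  qed
qed

lemma tr_sem: "string_diagram D \<Longrightarrow> tr (sem D) y c = Some d' \<longleftrightarrow> (y, c, d') \<in> trans_of D"
proof (induction D arbitrary: y c d')
  case (Const A)
  then show ?case
    by (auto simp: const_sem_def tr_relabel inj_def is_omdp_def trans_of_def link_def)
next
  case (Seq D E)
  then interpret seq_composable "sem D" "sem E"
    by unfold_locales (auto simp: is_omdp_sem)
  have "(y, c, d') \<in> trans_of (Seq D E) \<longleftrightarrow>
      (\<exists>x b d. y = place (Inl x) \<and> c = place (Inl b) \<and> (x, b, d) \<in> trans_of D \<and>
        d' = map_pmf place (map_pmf (redirect (sem D) (sem E) \<circ> Inl) d)) \<or>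
      (\<exists>x b d. y = place (Inr x) \<and> c = place (Inr b) \<and> (x, b, d) \<in> trans_of E \<and>
        d' = map_pmf place (map_pmf (redirect (sem D) (sem E) \<circ> Inr) d))"
    using Seq.prems by (intro trans_of_composite link_Seq) auto
  moreover have "tr (sem (Seq D E)) y c = Some d' \<longleftrightarrow>
      (\<exists>x b d. y = place x \<and> c = place b \<and>
         union_tr (redirect (sem D) (sem E)) (sem D) (sem E) x b = Some d \<and> d' = map_pmf place d)"
    using tr_relabel[OF inj_place inj_place is_omdpD(1)[OF is_omdp_seq_comp]]
    by (simp add: seq_sem_def seq_comp_def)
  moreover have "tr (sem D) x b = Some d \<longleftrightarrow> (x, b, d) \<in> trans_of D"
      "tr (sem E) x b = Some d \<longleftrightarrow> (x, b, d) \<in> trans_of E" for x b d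
    using Seq by simp_all
  ultimately show ?case
    by (simp only: tr_relabel_union)
next
  case (Sum D E)
  have "(y, c, d') \<in> trans_of (Sum D E) \<longleftrightarrow>
      (\<exists>x b d. y = place (Inl x) \<and> c = place (Inl b) \<and> (x, b, d) \<in> trans_of D \<and>
        d' = map_pmf place (map_pmf (id \<circ> Inl) d)) \<or>
      (\<exists>x b d. y = place (Inr x) \<and> c = place (Inr b) \<and> (x, b, d) \<in> trans_of E \<and>
        d' = map_pmf place (map_pmf (id \<circ> Inr) d))"
    by (rule trans_of_composite) (use Sum.prems link_Sum[OF Sum.prems] in simp_all)
  moreover have mdp: "is_mdp (sum_comp (sem D) (sem E))"
    by (intro is_omdpD(1) is_omdp_sum_comp is_omdp_sem) (use Sum.prems in simp_all)
  then have "tr (sem (Sum D E)) y c = Some d' \<longleftrightarrow>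
      (\<exists>x b d. y = place x \<and> c = place b \<and>
         union_tr id (sem D) (sem E) x b = Some d \<and> d' = map_pmf place d)"
    using tr_relabel[OF inj_place inj_place mdp]
    by (simp add: sum_sem_def sum_comp_def)
  moreover have "tr (sem D) x b = Some d \<longleftrightarrow> (x, b, d) \<in> trans_of D"
      "tr (sem E) x b = Some d \<longleftrightarrow> (x, b, d) \<in> trans_of E" for x b d
    using Sum by simp_all
  ultimately show ?case
    by (simp only: tr_relabel_union)
qed

section \<open>Global values from local values\<close>

definition exit_or_max :: "('s, 'a) omdp \<Rightarrow> ('s \<Rightarrow> real) \<Rightarrow> 's \<Rightarrow> real" where
  "exit_or_max A v s = (if s \<in> exits A then v s else WRPr_max A v s)"

lemma supersol_exit_or_max:
  "is_omdp A \<Longrightarrow> (\<And>e. e \<in> exits A \<Longrightarrow> v e \<in> {0..1}) \<Longrightarrow> supersol A v (exit_or_max A v)"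
  unfolding exit_or_max_def by (rule supersol_WRPr_max(1))

lemma exit_or_max_bounds:
  assumes "is_omdp A" "\<And>e. e \<in> exits A \<Longrightarrow> v e \<in> {0..1}" "s \<in> states A"
  shows "exit_or_max A v s \<in> {0..1}"
  using WRPr_max_bounds(1,2)[OF assms] assms(2)[of s] by (auto simp: exit_or_max_def)

lemma expectation_mono:
  fixes f g :: "'s \<Rightarrow> real"
  assumes "finite (set_pmf d)" "\<And>s. s \<in> set_pmf d \<Longrightarrow> f s \<le> g s"
  shows "measure_pmf.expectation d f \<le> measure_pmf.expectation d g"
  using assms
  by (intro integral_mono_AE integrable_measure_pmf_finite) (auto simp: AE_measure_pmf_iff)

lemma local_ofI: "(p, A) \<in> CP D \<Longrightarrow> x \<in> X A \<Longrightarrow> (p, x) \<in> local_of X D"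
  by (auto simp: local_of_def)

lemma local_ofE:
  assumes "y \<in> local_of X D"
  obtains p A x where "y = (p, x)" "(p, A) \<in> CP D" "x \<in> X A"
  using assms by (auto simp: local_of_def)

lemma local_exit_cases:
  assumes "string_diagram D" "e \<in> local_of exits D"
  obtains "e \<in> exits (sem D)" "link D e = e" "\<And>g w. propagate D g w e = w e"
  | "link D e \<in> local_of entrances D" "e \<notin> exits (sem D)"
    "\<And>g w. propagate D g w e = g (link D e)"
proof (cases "e \<in> Domain (links D)")
  case True
  then have "link D e \<in> local_of entrances D"
    using link_eq[OF assms(1)] Range_links[OF assms(1)] by (metis DomainE RangeI subsetD)
  moreover have "e \<notin> exits (sem D)"
    using exits_sem(2)[OF assms(1)] True by blast
  ultimately show ?thesis
    using that(2) True by (auto simp: propagate_def link_def)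
next
  case False
  then have "e \<in> exits (sem D)"
    using exits_sem(1)[OF assms(1)] assms(2) by blast
  then show ?thesis
    using that(1) False by (auto simp: propagate_def link_other)
qed

lemma propagate_bounds:
  assumes "string_diagram D" "w \<in> exits (sem D) \<rightarrow> {0..1}"
    and "\<And>i. i \<in> local_of entrances D \<Longrightarrow> g i \<in> {0..1}" "e \<in> local_of exits D"
  shows "propagate D g w e \<in> {0..1}"
  using assms(1,4) by (rule local_exit_cases) (use assms in auto)

lemma local_le_global:
  assumes D: "string_diagram D" and w: "w \<in> exits (sem D) \<rightarrow> {0..1}" and A: "(p, A) \<in> CP D"
    and v: "\<And>e. e \<in> exits A \<Longrightarrow> v e \<le> exit_or_max (sem D) w (link D (p, e))"
    and s: "s \<in> states A"
  shows "WRPr_max A v s \<le> exit_or_max (sem D) w (link D (p, s))"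
proof (rule WRPr_max_le_supersol[OF is_omdp_CP[OF D A] _ s])
  note omdp = is_omdp_CP[OF D A] is_omdp_sem[OF D]
  have w': "w e \<in> {0..1}" if "e \<in> exits (sem D)" for e
    using w that by auto
  have super: "supersol (sem D) w (exit_or_max (sem D) w)"
    by (rule supersol_exit_or_max[OF omdp(2) w'])
  show "supersol A v (\<lambda>s. exit_or_max (sem D) w (link D (p, s)))"
    unfolding supersol_def
  proof (intro conjI ballI allI impI)
    fix s assume "s \<in> states A"
    then have "link D (p, s) \<in> states (sem D)"
      by (intro link_states D local_ofI[OF A])
    then show "0 \<le> exit_or_max (sem D) w (link D (p, s))"
      using super by (simp add: supersol_def)
  next
    fix s a d assume d: "tr A s a = Some d"
    let ?d' = "map_pmf (\<lambda>s'. link D (p, s')) d"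
    have tr: "tr (sem D) (p, s) (p, a) = Some ?d'"
      using d A D by (auto simp: tr_sem trans_of_def)
    then have "(p, s) \<in> states (sem D)"
      using is_omdpD(1)[OF omdp(2)] by (auto simp: is_mdp_def)
    \<comment> \<open>The source of a transition is a state of \<open>sem D\<close>, hence no linked
      exit, so \<open>link\<close> changes only targets and the global inequality at
      \<open>(p, s)\<close> is the one required.\<close>
    then have "link D (p, s) = (p, s)"
      using states_sem[OF D] by (intro link_other) auto
    then show "measure_pmf.expectation d (\<lambda>s. exit_or_max (sem D) w (link D (p, s))) \<le>
        exit_or_max (sem D) w (link D (p, s))"
      using super tr by (fastforce simp: supersol_def)
  qed (rule v)
qed

lemma Psi_eq:
  assumes "(p, A) \<in> CP D"
  shows "Psi D w x (p, i) = Max (insert 0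
    ((\<lambda>\<sigma>. weighted A (\<lambda>e. propagate D x w (p, e)) \<sigma> i) ` dm_schedulers A))"
proof -
  have "(THE A. (p, A) \<in> CP D) = A"
    using assms CP_unique by (intro the_equality) auto
  then show ?thesis
    by (simp only: Psi_def weighted_def prod.case Let_def mult.commute)
qed

text \<open>At a linked exit \<open>e\<close> two numbers meet: the weight \<open>x i_e\<close> seen
  by the component and the glued value \<open>F i_e\<close> at the entrance that replaces it. The
  prefixed point inequality gives \<open>F i_e \<le> x i_e\<close>, so redirecting transitions only
  lowers expectations and the Bellman inequalities of the components survive.\<close>

lemma global_le_prefixpoint:
  assumes D: "string_diagram D" and w: "w \<in> exits (sem D) \<rightarrow> {0..1}"
    and x: "\<And>i. i \<in> local_of entrances D \<Longrightarrow> x i \<in> {0..1}"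
    and Psi: "\<And>i. i \<in> local_of entrances D \<Longrightarrow> Psi D w x i \<le> x i"
    and i: "i \<in> local_of entrances D"
  shows "WRPr_max (sem D) w i \<le> x i"
proof -
  define v where "v p e = propagate D x w (p, e)" for p e
  define F where "F = (\<lambda>(p, s). exit_or_max (THE A. (p, A) \<in> CP D) (v p) s)"
  have F: "F (p, s) = exit_or_max A (v p) s" if "(p, A) \<in> CP D" for p A s
  proof -
    have "(THE A. (p, A) \<in> CP D) = A"
      using that CP_unique by (intro the_equality) auto
    then show ?thesis by (simp add: F_def)
  qed
  have v: "v p e \<in> {0..1}" if "(p, A) \<in> CP D" "e \<in> exits A" for p A e
    unfolding v_def using that by (intro propagate_bounds[OF D w x] local_ofI)
  have F_entrance: "F j \<le> x j" if j: "j \<in> local_of entrances D" for j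
  proof -
    obtain q B k where B: "j = (q, k)" "(q, B) \<in> CP D" "k \<in> entrances B"
      using j by (rule local_ofE)
    note omdp = is_omdp_CP[OF D B(2)]
    have k: "k \<in> states B - exits B"
      using B(3) is_omdpD[OF omdp] by auto
    have "F j = WRPr_max B (v q) k"
      using k by (simp add: B(1) F[OF B(2)] exit_or_max_def)
    \<comment> \<open>The supremum over all schedulers is bounded by the maximum over DM schedulers
      in \<open>Psi\<close>, because an optimal DM scheduler exists.\<close>
    also have "\<dots> \<le> Psi D w x j"
      unfolding B(1) Psi_eq[OF B(2)] using supersol_WRPr_max(2)[of B "v q" k] omdp v[OF B(2)] k
      unfolding v_def[abs_def] by blast
    also have "\<dots> \<le> x j"
      by (rule Psi[OF j])
    finally show ?thesis .
  qed
  have F_link: "F (link D (p, s)) \<le> exit_or_max A (v p) s" if A: "(p, A) \<in> CP D" and s: "s \<in> states A" for p A s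
  proof (cases "(p, s) \<in> local_of exits D")
    case True
    then have "s \<in> exits A"
      using CP_unique[OF A] by (auto simp: local_of_def)
    then have eq: "exit_or_max A (v p) s = propagate D x w (p, s)"
      by (simp add: exit_or_max_def v_def)
    from D True show ?thesis
    proof (cases rule: local_exit_cases)
      case 1
      then show ?thesis by (simp add: F[OF A])
    next
      case 2
      then show ?thesis using F_entrance by (simp add: eq)
    qed
  next
    case False
    then have "(p, s) \<notin> Domain (links D)"
      using exits_sem(1)[OF D] by blast
    then show ?thesis
      by (simp add: link_other F[OF A])
  qed
  have "supersol (sem D) w F"
    unfolding supersol_def
  proof (intro conjI ballI allI impI)
    fix y assume "y \<in> states (sem D)"
    then have "y \<in> local_of states D"
      using states_sem[OF D] by auto
    then obtain p A s where A: "y = (p, s)" "(p, A) \<in> CP D" "s \<in> states A"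
      by (rule local_ofE)
    then show "0 \<le> F y"
      using exit_or_max_bounds[OF is_omdp_CP[OF D A(2)] v[OF A(2)] A(3)] F by simp
  next
    fix e assume e: "e \<in> exits (sem D)"
    then have "e \<in> local_of exits D"
      using exits_sem[OF D] by auto
    then obtain p A s where A: "e = (p, s)" "(p, A) \<in> CP D" "s \<in> exits A"
      by (rule local_ofE)
    then show "w e \<le> F e"
      using e by (simp add: F exit_or_max_def v_def propagate_def)
  next
    fix y c d' assume "tr (sem D) y c = Some d'"
    then have "(y, c, d') \<in> trans_of D"
      using tr_sem[OF D] by blast
    then obtain p s a A d where *: "(p, A) \<in> CP D" "tr A s a = Some d" "y = (p, s)"
      "d' = map_pmf (\<lambda>s'. link D (p, s')) d"
      by (rule trans_ofE)
    have d: "set_pmf d \<subseteq> states A" "finite (states A)"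
      using is_omdpD(1)[OF is_omdp_CP[OF D *(1)]] *(2) by (auto simp: is_mdp_def)
    have "measure_pmf.expectation d' F = measure_pmf.expectation d (\<lambda>s'. F (link D (p, s')))"
      by (simp add: *(4))
    also have "\<dots> \<le> measure_pmf.expectation d (exit_or_max A (v p))"
      using d F_link[OF *(1)] by (intro expectation_mono finite_subset[OF d]) auto
    also have "\<dots> \<le> exit_or_max A (v p) s"
      using supersol_exit_or_max[OF is_omdp_CP[OF D *(1)] v[OF *(1)]] *(2)
      by (auto simp: supersol_def)
    finally show "measure_pmf.expectation d' F \<le> F y"
      by (simp add: *(3) F[OF *(1)])
  qed
  then have "WRPr_max (sem D) w i \<le> F i"
    by (intro WRPr_max_le_supersol is_omdp_sem D local_entrance_not_exit(3) i)
  then show ?thesis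
    using F_entrance[OF i] by simp
qed

section \<open>Soundness of the cache\<close>

text \<open>
  Sound lower approximations are described by their support functions.  This avoids proving that
  the points achieved by memoryless schedulers form a convex set.
\<close>

definition below_max :: "('s, 'a) omdp \<Rightarrow> 's \<Rightarrow> ('s \<Rightarrow> real) set" where
  "below_max A i = {p. \<forall>v. (\<forall>e\<in>exits A. v e \<in> {0..1}) \<longrightarrow> wsum A v p \<le> WRPr_max A v i}"

text \<open>The upper sets need the full geometric property because the bottom-up combinations
  assume it, while the lower sets are only ever read through weighted suprema. The cache is a total
  function, so the invariant covers all oMDPs and not just those occurring in a diagram.\<close>

definition cache_sound :: "('s, 'a) cache \<Rightarrow> bool" where
  "cache_sound C \<longleftrightarrow> (\<forall>A. is_omdp A \<longrightarrow> over_approx A (upper C A) \<and>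
     (\<forall>i\<in>entrances A. lower C A i \<subseteq> below_max A i))"

lemma wsum_mono:
  assumes "\<And>e. e \<in> exits A \<Longrightarrow> v e \<ge> 0" "\<And>e. e \<in> exits A \<Longrightarrow> q e \<le> p e"
  shows "wsum A v q \<le> wsum A v p"
  using assms by (auto simp: wsum_def intro!: sum_mono mult_left_mono)

lemma wsum_reach_pt: "wsum A v (reach_pt A \<sigma> i) = weighted A v \<sigma> i"
  by (simp add: wsum_def reach_pt_def weighted_def)

text \<open>\<open>below_max A i\<close> is an intersection of half-spaces with nonnegative normals,
  hence downward closed and convex itself, and so contains the hull.\<close>

lemma dc_closure_below_max:
  assumes "X \<subseteq> below_max A i"
  shows "dc_closure A X \<subseteq> below_max A i"
  unfolding dc_closure_def
proof (rule hull_minimal[OF assms], intro conjI)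
  show "down_closed A (below_max A i)"
    unfolding down_closed_def below_max_def
  proof (intro ballI impI CollectI allI)
    fix p q v assume *: "p \<in> {p. \<forall>v. (\<forall>e\<in>exits A. v e \<in> {0..1}) \<longrightarrow> wsum A v p \<le> WRPr_max A v i}"
      "\<forall>e\<in>exits A. q e \<le> p e" "\<forall>e\<in>exits A. v e \<in> {0..1::real}"
    then have "wsum A v q \<le> wsum A v p"
      by (intro wsum_mono) auto
    then show "wsum A v q \<le> WRPr_max A v i"
      using * by fastforce
  qed
  show "convex_pts A (below_max A i)"
    unfolding convex_pts_def below_max_def
  proof (intro ballI CollectI allI impI)
    fix p q v and t :: real
    assume p: "p \<in> {p. \<forall>v. (\<forall>e\<in>exits A. v e \<in> {0..1}) \<longrightarrow> wsum A v p \<le> WRPr_max A v i}"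
      and q: "q \<in> {p. \<forall>v. (\<forall>e\<in>exits A. v e \<in> {0..1}) \<longrightarrow> wsum A v p \<le> WRPr_max A v i}"
      and t: "t \<in> {0..1}" and v: "\<forall>e\<in>exits A. v e \<in> {0..1::real}"
    have "wsum A v (\<lambda>e\<in>exits A. (1 - t) * p e + t * q e) = (1 - t) * wsum A v p + t * wsum A v q"
      by (simp add: wsum_def sum_distrib_left sum.distrib[symmetric] algebra_simps)
    also have "\<dots> \<le> WRPr_max A v i"
      using p q t v by (intro convex_bound_le) auto
    finally show "wsum A v (\<lambda>e\<in>exits A. (1 - t) * p e + t * q e) \<le> WRPr_max A v i" .
  qed
qed

lemma RPr_le_1:
  assumes "is_mdp M" "t \<in> states M" "s \<in> states M"
  shows "RPr M \<sigma> t s \<le> 1"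
  by (rule LIMSEQ_le_const2[OF hit_tendsto_RPr[OF assms]]) (simp add: hit_le_1[OF assms(1)])

lemma reach_pt_achievable:
  assumes "is_omdp A" "i \<in> states A" "\<sigma> \<in> schedulers A"
  shows "reach_pt A \<sigma> i \<in> achievable A i"
proof -
  have "RPr A \<sigma> e i \<in> {0..1}" if "e \<in> exits A" for e
    using RPr_nonneg[of A e i \<sigma>] RPr_le_1[of A e i \<sigma>] is_omdpD(1,5)[OF assms(1)] assms(2) that
    by auto
  then show ?thesis
    using assms(3) by (auto simp: achievable_def cube_def reach_pt_def)
qed

lemma wsum_achievable_le:
  assumes A: "is_omdp A" and v: "\<And>e. e \<in> exits A \<Longrightarrow> v e \<in> {0..1}" and i: "i \<in> states A"
    and p: "p \<in> achievable A i"
  shows "wsum A v p \<le> WRPr_max A v i"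
proof -
  obtain \<sigma> where \<sigma>: "\<sigma> \<in> schedulers A" "\<forall>e\<in>exits A. p e \<le> reach_pt A \<sigma> i e"
    using p by (auto simp: achievable_def)
  then have "wsum A v p \<le> wsum A v (reach_pt A \<sigma> i)"
    using v by (intro wsum_mono) auto
  also have "\<dots> \<le> WRPr_max A v i"
    unfolding wsum_reach_pt using WRPr_max_bounds(3)[OF A v i \<sigma>(1)] .
  finally show ?thesis .
qed

lemma over_approx_cut:
  assumes A: "is_omdp A" and v: "\<And>e. e \<in> exits A \<Longrightarrow> v e \<in> {0..1}" and U: "over_approx A U"
    and u: "\<And>i. i \<in> entrances A \<Longrightarrow> WRPr_max A v i \<le> u i"
  shows "over_approx A (\<lambda>i. U i \<inter> {p. wsum A v p \<le> u i})"
  unfolding over_approx_def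
proof (intro ballI conjI)
  fix i assume i: "i \<in> entrances A"
  show "U i \<inter> {p. wsum A v p \<le> u i} \<subseteq> cube A"
    using U i by (auto simp: over_approx_def)
  have "wsum A v q \<le> wsum A v p" if "\<forall>e\<in>exits A. q e \<le> p e" for p q
    using that v by (intro wsum_mono) auto
  then have "wsum A v q \<le> u i" if "\<forall>e\<in>exits A. q e \<le> p e" "wsum A v p \<le> u i" for p q
    using that by fastforce
  moreover have "down_closed A (U i)"
    using U i by (simp add: over_approx_def)
  ultimately show "down_closed A (U i \<inter> {p. wsum A v p \<le> u i})"
    unfolding down_closed_def by blast
  have "wsum A v p \<le> u i" if "p \<in> achievable A i" for p
    using wsum_achievable_le[OF A v _ that] u[OF i] is_omdpD(6)[OF A] i by fastforce
  then show "achievable A i \<subseteq> U i \<inter> {p. wsum A v p \<le> u i}"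
    using U i by (auto simp: over_approx_def)
qed

lemma cache_sound_init: "cache_sound \<lparr>lower = \<lambda>A i. {}, upper = \<lambda>A i. cube A\<rparr>"
  by (auto simp: cache_sound_def over_approx_def down_closed_def achievable_def)

text \<open>The added lower point is achieved by an actual scheduler, so it respects the maximum for
  every weight and not only for \<open>v\<close>. The cut at \<open>v\<close> removes no achievable
  point. Both facts keep later reads at other weights sound.\<close>

lemma cache_sound_update:
  assumes C: "cache_sound C" and A: "is_omdp A" and v: "\<And>e. e \<in> exits A \<Longrightarrow> v e \<in> {0..1}"
    and vi: "local_vi_result \<eta> A v l u \<sigma>"
  shows "cache_sound (cache_update A v u \<sigma> C)"
  unfolding cache_sound_def
proof (intro allI impI conjI ballI)
  fix B :: "('a, 'b) omdp" assume B: "is_omdp B"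
  note * = C[unfolded cache_sound_def, rule_format, OF B]
  have "over_approx A (\<lambda>i. upper C A i \<inter> {p. wsum A v p \<le> u i})"
    using A C vi v by (intro over_approx_cut) (auto simp: cache_sound_def local_vi_result_def)
  then show "over_approx B (upper (cache_update A v u \<sigma> C) B)"
    using * by (simp add: cache_update_def)
  fix i assume i: "i \<in> entrances B"
  have "reach_pt A \<sigma> i \<in> below_max A i" if "B = A"
  proof -
    have "\<sigma> \<in> schedulers A" "i \<in> states A"
      using vi dm_schedulers_subset is_omdpD(6)[OF A] i that by (auto simp: local_vi_result_def)
    then show ?thesis
      unfolding below_max_def using wsum_achievable_le[OF A] reach_pt_achievable[OF A] by blast
  qed
  moreover have "lower C B i \<subseteq> below_max B i"
    using * i by simp
  ultimately show "lower (cache_update A v u \<sigma> C) B i \<subseteq> below_max B i"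
    using dc_closure_below_max[of "lower C B i \<union> {reach_pt A \<sigma> i}" B i]
    by (cases "B = A") (simp_all add: cache_update_def)
qed

lemma cache_read_bounds:
  assumes C: "cache_sound C" and A: "is_omdp A" and v: "\<And>e. e \<in> exits A \<Longrightarrow> v e \<in> {0..1}"
    and i: "i \<in> entrances A"
  shows "0 \<le> cache_read A (lower C A i) v" "cache_read A (lower C A i) v \<le> WRPr_max A v i"
proof -
  have "x \<le> WRPr_max A v i" if "x \<in> wsum A v ` lower C A i" for x
    using C A v i that by (fastforce simp: cache_sound_def below_max_def)
  \<comment> \<open>Covers the default 0 inserted by \<open>sup0\<close>, which is what the
    initially empty lower sets return.\<close>
  moreover have "0 \<le> WRPr_max A v i"
    using WRPr_max_bounds(1)[OF A v] is_omdpD(6)[OF A] i by auto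
  ultimately show "0 \<le> cache_read A (lower C A i) v"
      "cache_read A (lower C A i) v \<le> WRPr_max A v i"
    unfolding cache_read_def by (blast intro: sup0_bounds(1,2))+
qed

section \<open>Soundness of the rounds\<close>

text \<open>The disjunction is the induction invariant: each component is still to be visited or
  already has correct values. With all of \<open>CP D\<close> in the list the first alternative
  always applies, so nothing is required of the previous \<open>g\<close>. Only lower correctness is
  tracked, which hits and misses provide alike.\<close>

lemma visits_sound:
  assumes "visits \<eta> h cs S S'" "string_diagram D" "set cs \<subseteq> CP D" "cache_sound (fst S)"
    and "\<And>e. e \<in> local_of exits D \<Longrightarrow> h e \<in> {0..1}"
  defines "ok \<equiv> \<lambda>g p A i. 0 \<le> g (p, i) \<and> g (p, i) \<le> WRPr_max A (\<lambda>e. h (p, e)) i"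
  shows "cache_sound (fst S') \<and> (\<forall>p A i. (p, A) \<in> CP D \<longrightarrow> i \<in> entrances A \<longrightarrow>
    (p, A) \<in> set cs \<or> ok (snd S) p A i \<longrightarrow> ok (snd S') p A i)"
proof -
  have upd: "(q, B) \<in> set cs \<or> ok (set_local p A gA g) q B i"
    if "(p, A) \<in> CP D" "(q, B) \<in> CP D" "i \<in> entrances B" "(q, B) \<in> set ((p, A) # cs) \<or> ok g q B i"
      and "\<And>i. i \<in> entrances A \<Longrightarrow> 0 \<le> gA i \<and> gA i \<le> WRPr_max A (\<lambda>e. h (p, e)) i"
    for p q A B i cs g gA
  proof (cases "q = p")
    case True
    then have "B = A"
      using that CP_unique by blast
    then show ?thesis
      using True that(3,5) by (simp add: ok_def set_local_def)
  next
    case False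
    then show ?thesis
      using that(4) by (auto simp: ok_def set_local_def)
  qed
  from assms(1,3,4) show ?thesis
  proof (induction rule: visits.induct)
    case (vis_done C g)
    then show ?case by simp
  next
    case (vis_hit v p A C cs g S)
    have A: "(p, A) \<in> CP D" "is_omdp A" "set cs \<subseteq> CP D"
      using vis_hit.prems(1) is_omdp_CP[OF assms(2), of p A] by simp_all
    have v: "v e \<in> {0..1}" if "e \<in> exits A" for e
      using assms(5)[OF local_ofI[OF A(1), where X = exits, OF that]] vis_hit.hyps by simp
    have gA: "0 \<le> cache_read A (lower C A i) v \<and>
        cache_read A (lower C A i) v \<le> WRPr_max A (\<lambda>e. h (p, e)) i" if "i \<in> entrances A" for i
      using cache_read_bounds[of C A v i] vis_hit.prems A(2) that v
      unfolding vis_hit.hyps(1) by simp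
    show ?case
      using vis_hit.IH[OF A(3)] vis_hit.prems(2) upd[OF A(1) _ _ _ gA, of _ _ _ cs g]
      unfolding fst_conv snd_conv by blast
  next
    case (vis_miss v p A C l u \<sigma> cs g S)
    have A: "(p, A) \<in> CP D" "is_omdp A" "set cs \<subseteq> CP D"
      using vis_miss.prems(1) is_omdp_CP[OF assms(2), of p A] by simp_all
    have v: "v e \<in> {0..1}" if "e \<in> exits A" for e
      using assms(5)[OF local_ofI[OF A(1), where X = exits, OF that]] vis_miss.hyps by simp
    have gA: "0 \<le> l i \<and> l i \<le> WRPr_max A (\<lambda>e. h (p, e)) i" if "i \<in> entrances A" for i
      using vis_miss.hyps(3) that unfolding vis_miss.hyps(1) by (simp add: local_vi_result_def)
    have "cache_sound (cache_update A v u \<sigma> C)"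
      using cache_sound_update[OF _ A(2) v vis_miss.hyps(3)] vis_miss.prems(2) by simp
    then show ?case
      using vis_miss.IH[OF A(3)] upd[OF A(1) _ _ _ gA, of _ _ _ cs g]
      unfolding fst_conv snd_conv by blast
  qed
qed

text \<open>Bounding \<open>h\<close> through \<open>link\<close> treats a global exit and the
  entrance behind a linked exit uniformly, and is exactly the hypothesis that
  \<open>local_le_global\<close> needs in the next round. The range of \<open>h\<close> keeps the
  weights legitimate for cache reads and local iterations.\<close>

lemma cvi_reachable_sound:
  assumes "cvi_reachable D w \<eta> gsc S" and D: "string_diagram D"
    and w: "w \<in> exits (sem D) \<rightarrow> {0..1}"
  shows "case S of (C, g, h) \<Rightarrow> cache_sound C \<and>
    (\<forall>e\<in>local_of exits D. h e \<in> {0..1} \<and> h e \<le> exit_or_max (sem D) w (link D e)) \<and>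
    (\<forall>i\<in>local_of entrances D. 0 \<le> g i \<and> g i \<le> exit_or_max (sem D) w i)"
  using assms(1)
proof (induction rule: cvi_reachable.induct)
  let ?val = "exit_or_max (sem D) w"
  have w': "w e \<in> {0..1}" if "e \<in> exits (sem D)" for e
    using w that by auto
  have val: "?val y \<in> {0..1}" if "y \<in> states (sem D)" for y
    using exit_or_max_bounds[OF is_omdp_sem[OF D] w' that] .
  have val_exit: "?val e = w e" if "e \<in> exits (sem D)" for e
    using that by (simp add: exit_or_max_def)
  {
    case cvi_start
    have "0 \<le> ?val i" if "i \<in> local_of entrances D" for i
      using val[OF local_entrance_not_exit(3)[OF D that]] by simp
    moreover have "(if e \<in> exits (sem D) then w e else 0) \<in> {0..1} \<and>
        (if e \<in> exits (sem D) then w e else 0) \<le> ?val (link D e)" if "e \<in> local_of exits D" for e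
      using D that
    proof (cases rule: local_exit_cases)
      case 1
      then show ?thesis using w' val_exit by simp
    next
      case 2
      then show ?thesis using val[OF local_entrance_not_exit(3)[OF D]] by simp
    qed
    ultimately show ?case
      using cache_sound_init by (simp add: cvi_init_def)
  next
    case (cvi_step C g h S)
    obtain C' g' h' where S: "S = (C', g', h')"
      by (cases S)
    obtain cs where cs: "set cs = CP D" "visits \<eta> h cs (C, g) (C', g')" "h' = propagate D g' w"
      using cvi_step.hyps(3) by (auto simp: cvi_round_def S)
    have C: "cache_sound C" and h: "\<And>e. e \<in> local_of exits D \<Longrightarrow> h e \<in> {0..1}"
        "\<And>e. e \<in> local_of exits D \<Longrightarrow> h e \<le> ?val (link D e)"
      using cvi_step.IH by auto
    have *: "cache_sound C'" "\<And>p A i. (p, A) \<in> CP D \<Longrightarrow> i \<in> entrances A \<Longrightarrow>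
        0 \<le> g' (p, i) \<and> g' (p, i) \<le> WRPr_max A (\<lambda>e. h (p, e)) i"
      using visits_sound[OF cs(2) D _ _ h(1)] C cs(1) by simp_all
    have g': "0 \<le> g' i \<and> g' i \<le> ?val i" if i: "i \<in> local_of entrances D" for i
    proof -
      obtain p A j where A: "i = (p, j)" "(p, A) \<in> CP D" "j \<in> entrances A"
        using i by (rule local_ofE)
      have "0 \<le> g' i" "g' i \<le> WRPr_max A (\<lambda>e. h (p, e)) j"
        using * A by auto
      moreover have "j \<in> states A"
        using is_omdpD(6)[OF is_omdp_CP[OF D A(2)]] A(3) by blast
      then have "WRPr_max A (\<lambda>e. h (p, e)) j \<le> ?val (link D i)"
        unfolding A(1) by (intro local_le_global[OF D w A(2)] h(2) local_ofI[OF A(2)])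
      moreover have "link D i = i"
        using local_entrance_not_exit(2)[OF D i] by (rule link_other)
      ultimately show ?thesis by simp
    qed
    have "h' e \<in> {0..1} \<and> h' e \<le> ?val (link D e)" if "e \<in> local_of exits D" for e
      using D that
    proof (cases rule: local_exit_cases)
      case 1
      then show ?thesis using w' val_exit by (simp add: cs(3))
    next
      case 2
      then show ?thesis
        using g'[OF 2(1)] val[OF local_entrance_not_exit(3)[OF D 2(1)]] by (simp add: cs(3))
    qed
    then show ?case
      using * g' by (simp add: S)
  }
qed

section \<open>Soundness of the bottom-up criterion\<close>

lemma pmf_relabel_scheduler:
  assumes "inj k" "set_pmf \<mu> \<subseteq> range k"
  shows "pmf (map_pmf (inv k) \<mu>) a = pmf \<mu> (k a)"
proof -
  have "map_pmf k (map_pmf (inv k) \<mu>) = \<mu>"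
    unfolding pmf.map_comp o_def using assms
    by (intro map_pmf_idI) (auto simp: f_inv_into_f subset_iff)
  then show ?thesis
    using pmf_map_inj'[OF assms(1), of "map_pmf (inv k) \<mu>" a] by simp
qed

lemma tr_prob_relabel:
  assumes "inj f" "inj k" "is_mdp A"
  shows "tr_prob (relabel f k A) (f s) (k a) (f s') = tr_prob A s a s'"
proof (cases "tr A s a")
  case None
  then have "tr (relabel f k A) (f s) (k a) \<noteq> Some d" for d
    using assms by (simp add: tr_relabel inj_eq)
  then show ?thesis
    using None by (simp add: tr_prob_def split: option.split)
next
  case (Some d)
  then have "tr (relabel f k A) (f s) (k a) = Some (map_pmf f d)"
    unfolding tr_relabel[OF assms] by blast
  then show ?thesis
    using Some assms(1) by (simp add: tr_prob_def pmf_map_inj')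
qed

text \<open>The finite-horizon probabilities agree by induction and limits are unique, which avoids
  a bijection between path sets. The scheduler of the copy is the given one, because
  over-approximation must account for every scheduler there.\<close>

lemma RPr_relabel:
  assumes fk: "inj f" "inj k" and A: "is_mdp A"
    and \<sigma>: "\<And>s. s \<in> states A \<Longrightarrow> set_pmf (\<sigma> (f s)) \<subseteq> range k"
    and \<tau>: "\<And>s. s \<in> states A \<Longrightarrow> \<tau> s = map_pmf (inv k) (\<sigma> (f s))"
    and st: "s \<in> states A" "t \<in> states A" and A': "is_mdp (relabel f k A)"
  shows "RPr (relabel f k A) \<sigma> (f t) (f s) = RPr A \<tau> t s"
proof -
  have inj_on: "inj_on f X" "inj_on k Y" for X Y
    using fk by (auto intro: inj_on_subset)
  have kernel: "kernel (relabel f k A) \<sigma> (f s) (f s') = kernel A \<tau> s s'" if "s \<in> states A" for s s'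
    using that pmf_relabel_scheduler[OF fk(2) \<sigma>] \<tau>
    by (simp add: kernel_def sum.reindex[OF inj_on(2)] tr_prob_relabel[OF fk A])
  have "hit (relabel f k A) \<sigma> (f t) n (f s) = hit A \<tau> t n s" if "s \<in> states A" for n s
    using that
  proof (induction n arbitrary: s)
    case (Suc n)
    then show ?case
      by (simp add: sum.reindex[OF inj_on(1)] kernel inj_eq[OF fk(1)])
  qed simp
  then have "(\<lambda>n. hit A \<tau> t n s) \<longlonglongrightarrow> RPr (relabel f k A) \<sigma> (f t) (f s)"
    using hit_tendsto_RPr[OF A', of "f t" "f s" \<sigma>] st by simp
  then show ?thesis
    using hit_tendsto_RPr[OF A st(2,1)] by (rule LIMSEQ_unique)
qed

text \<open>Base case of the bottom-up computation: the cache speaks about the oMDP of a constant,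
  the combinations about its placed copy.\<close>

lemma over_approx_const_sem:
  assumes A: "is_omdp A" and U: "over_approx A U"
  shows "over_approx (const_sem A) (\<lambda>i. (\<lambda>p. \<lambda>e\<in>exits (const_sem A). p (snd e)) ` U (snd i))"
  unfolding over_approx_def
proof (intro ballI)
  fix i assume "i \<in> entrances (const_sem A)"
  then obtain j where i: "i = ([], j)" and j: "j \<in> entrances A"
    by (auto simp: const_sem_def)
  define up where "up p = (\<lambda>e\<in>exits (const_sem A). p (snd e))" for p :: "'a \<Rightarrow> real"
  define dn where "dn q = (\<lambda>e\<in>exits A. q ([], e))" for q :: "'a placed \<Rightarrow> real"
  have ex: "exits (const_sem A) = Pair [] ` exits A"
    by (simp add: const_sem_def)
  \<comment> \<open>Points of the cube are extensional, so restricting and transporting back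
    recovers them outside the exits as well.\<close>
  have up_dn: "up (dn q) = q" if "q \<in> cube (const_sem A)" for q
    using that unfolding cube_def ex by (auto simp: up_def dn_def ex fun_eq_iff PiE_def extensional_def)
  have dn_cube: "dn q \<in> cube A" if "q \<in> cube (const_sem A)" for q
    using that unfolding cube_def ex by (auto simp: dn_def PiE_def Pi_iff)
  have Uj: "U j \<subseteq> cube A" "down_closed A (U j)" "achievable A j \<subseteq> U j"
    using U j by (auto simp: over_approx_def)
  have "up ` U j \<subseteq> cube (const_sem A)"
    using Uj(1) unfolding cube_def ex by (auto simp: up_def ex PiE_def Pi_iff)
  moreover have "down_closed (const_sem A) (up ` U j)"
    unfolding down_closed_def
  proof (intro ballI impI)
    fix p q assume "p \<in> up ` U j" and q: "q \<in> cube (const_sem A)"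
      "\<forall>e\<in>exits (const_sem A). q e \<le> p e"
    then obtain p' where p': "p' \<in> U j" "p = up p'"
      by auto
    then have "\<forall>e\<in>exits A. dn q e \<le> p' e"
      using q(2) by (simp add: ex dn_def up_def)
    then have "dn q \<in> U j"
      using Uj(2) p'(1) dn_cube[OF q(1)] unfolding down_closed_def by blast
    then show "q \<in> up ` U j"
      by (rule image_eqI[where f = up and x = "dn q", OF up_dn[OF q(1), symmetric]])
  qed
  moreover have "achievable (const_sem A) i \<subseteq> up ` U j"
  proof
    fix q assume "q \<in> achievable (const_sem A) i"
    then have *: "q \<in> cube (const_sem A) \<and> (\<exists>\<sigma>\<in>schedulers (const_sem A).
        \<forall>e\<in>exits (const_sem A). q e \<le> reach_pt (const_sem A) \<sigma> i e)"
      unfolding achievable_def mem_Collect_eq .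
    note q = conjunct1[OF *]
    from conjunct2[OF *] obtain \<sigma> where \<sigma>: "\<sigma> \<in> schedulers (const_sem A)"
      and le: "\<forall>e\<in>exits (const_sem A). q e \<le> reach_pt (const_sem A) \<sigma> i e"
      by (elim bexE)
    \<comment> \<open>An achievable point of the copy comes with a scheduler of the copy; stripping
      the position from its actions gives a scheduler of \<open>A\<close> with the same reachability
      probabilities.\<close>
    define \<tau> where "\<tau> = (\<lambda>s\<in>states A. map_pmf (inv (Pair [])) (\<sigma> ([], s)))"
    have \<sigma>_acts: "set_pmf (\<sigma> ([], s)) \<subseteq> Pair [] ` acts A" if "s \<in> states A" for s
      using \<sigma> that by (auto simp: schedulers_def const_sem_def PiE_def Pi_iff)
    have "\<tau> \<in> schedulers A"
      using \<sigma>_acts by (fastforce simp: schedulers_def \<tau>_def inv_f_f inj_def)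
    moreover have "RPr (const_sem A) \<sigma> ([], e) ([], j) = RPr A \<tau> e j" if "e \<in> exits A" for e
      unfolding const_sem_def
    proof (rule RPr_relabel)
      show "is_mdp (relabel (Pair []) (Pair []) A :: ('a placed, 'b placed) omdp)"
        using is_omdpD(1)[OF is_omdp_const_sem[OF A]] unfolding const_sem_def .
      show "set_pmf (\<sigma> ([], s)) \<subseteq> range (Pair [])" if "s \<in> states A" for s
        using \<sigma>_acts[OF that] by blast
      show "j \<in> states A" "e \<in> states A"
        using is_omdpD(5,6)[OF A] j that by blast+
    qed (simp_all add: \<tau>_def inj_def is_omdpD(1)[OF A])
    then have "\<forall>e\<in>exits A. dn q e \<le> reach_pt A \<tau> j e"
      using le by (simp add: dn_def reach_pt_def ex i)
    ultimately have "dn q \<in> U j"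
      using Uj(3) dn_cube[OF q] by (auto simp: achievable_def)
    then show "q \<in> up ` U j"
      by (rule image_eqI[where f = up and x = "dn q", OF up_dn[OF q, symmetric]])
  qed
  ultimately show "(\<lambda>p. \<lambda>e\<in>exits (const_sem A). p (snd e)) ` U (snd i) \<subseteq> cube (const_sem A) \<and>
      down_closed (const_sem A) ((\<lambda>p. \<lambda>e\<in>exits (const_sem A). p (snd e)) ` U (snd i)) \<and>
      achievable (const_sem A) i \<subseteq> (\<lambda>p. \<lambda>e\<in>exits (const_sem A). p (snd e)) ` U (snd i)"
    unfolding i snd_conv up_def[abs_def] by (intro conjI)
qed

lemma over_approx_bottom_up:
  assumes "sound_combinations bseq bsum" "cache_sound C" "string_diagram D"
  shows "over_approx (sem D) (bottom_up bseq bsum (upper C) D)"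
  using assms(3)
proof (induction D)
  case (Const A)
  then show ?case
    using assms(2) over_approx_const_sem[of A "upper C A"] by (simp add: cache_sound_def)
next
  case (Seq D E)
  then show ?case
    using assms(1) is_omdp_sem[of D] is_omdp_sem[of E] by (simp add: sound_combinations_def)
next
  case (Sum D E)
  then show ?case
    using assms(1) is_omdp_sem[of D] is_omdp_sem[of E] by (simp add: sound_combinations_def)
qed

lemma WRPr_max_le_over_approx:
  assumes A: "is_omdp A" and v: "\<And>e. e \<in> exits A \<Longrightarrow> v e \<in> {0..1}" and U: "over_approx A U"
    and i: "i \<in> entrances A"
  shows "WRPr_max A v i \<le> sup0 (wsum A v ` U i)"
proof -
  have "U i \<subseteq> cube A" and ach: "achievable A i \<subseteq> U i"
    using U i by (simp_all add: over_approx_def)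
  \<comment> \<open>The all-ones point dominates the cube; its weighted sum is the finite bound that
    makes the real supremum in \<open>sup0\<close> meaningful.\<close>
  then have le: "wsum A v p \<le> wsum A v (\<lambda>_. 1)" if "p \<in> U i" for p
    using v that by (intro wsum_mono) (auto simp: cube_def PiE_iff)
  have "0 \<le> wsum A v (\<lambda>_. 1)"
    using v by (auto simp: wsum_def intro!: sum_nonneg)
  note bounds = sup0_bounds[of "wsum A v ` U i" "wsum A v (\<lambda>_. 1)", OF _ this]
  have "weighted A v \<sigma> i \<le> sup0 (wsum A v ` U i)" if \<sigma>: "\<sigma> \<in> schedulers A" for \<sigma>
  proof -
    have "reach_pt A \<sigma> i \<in> U i"
      using reach_pt_achievable[OF A _ \<sigma>] is_omdpD(6)[OF A] ach i by blast
    then show ?thesis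
      unfolding wsum_reach_pt[symmetric] using le by (intro bounds(3)) auto
  qed
  then show ?thesis
    unfolding WRPr_max_eq using le bounds(1) by (intro sup0_bounds(2)) auto
qed

theorem theorem6p1:
  fixes D :: "('s, 'a) sdiag" and w f :: "'s placed \<Rightarrow> real" and \<epsilon> \<eta> :: real
    and gsc :: "('s, 'a) gsc"
  assumes "string_diagram D"
    and "w \<in> exits (sem D) \<rightarrow> {0..1}"
    and "\<epsilon> \<in> {0..1}" and "\<eta> \<in> {0..1}"
    and "gsc = opt_gsc D w \<epsilon> \<or>
         (\<exists>bseq bsum. sound_combinations bseq bsum \<and> gsc = bu_gsc bseq bsum D w \<epsilon>)"
    and "cvi_terminates_with D w \<eta> gsc f"
  shows "f \<in> entrances (sem D) \<rightarrow> {0..1} \<and>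
         (\<forall>i\<in>entrances (sem D).
            f i \<le> WRPr_max (sem D) w i \<and> WRPr_max (sem D) w i \<le> f i + \<epsilon>)"
proof -
  note D = assms(1) and w = assms(2) and omdp = is_omdp_sem[OF assms(1)]
  have w': "w e \<in> {0..1}" if "e \<in> exits (sem D)" for e
    using w that by auto
  obtain C g h where reach: "cvi_reachable D w \<eta> gsc (C, g, h)" and stop: "gsc C g True"
    and f: "f = restrict g (entrances (sem D))"
    using assms(6) by (auto simp: cvi_terminates_with_def)
  have C: "cache_sound C"
    and g: "\<And>i. i \<in> local_of entrances D \<Longrightarrow> 0 \<le> g i \<and> g i \<le> exit_or_max (sem D) w i"
    using cvi_reachable_sound[OF reach D w] by auto
  have "f i \<in> {0..1} \<and> f i \<le> WRPr_max (sem D) w i \<and> WRPr_max (sem D) w i \<le> f i + \<epsilon>"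
    if i: "i \<in> entrances (sem D)" for i
  proof -
    have i': "i \<in> local_of entrances D"
      using entrances_sem[OF D] i by blast
    have "exit_or_max (sem D) w i = WRPr_max (sem D) w i"
      using local_entrance_not_exit(1)[OF D i'] by (simp add: exit_or_max_def)
    moreover have "exit_or_max (sem D) w i \<le> 1"
      using exit_or_max_bounds[OF omdp w' local_entrance_not_exit(3)[OF D i']] by simp
    moreover have "WRPr_max (sem D) w i \<le> g i + \<epsilon>"
      using assms(5)
    proof
      assume "gsc = opt_gsc D w \<epsilon>"
      then obtain x where x: "x \<in> I_lc D \<rightarrow> {0..1}" "\<forall>i\<in>I_lc D. \<bar>x i - g i\<bar> \<le> \<epsilon>"
          "\<forall>i\<in>I_lc D. Psi D w x i \<le> x i"
        using stop by (auto simp: opt_gsc_def)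
      have "WRPr_max (sem D) w i \<le> x i"
        by (rule global_le_prefixpoint[OF D w _ _ i']) (use x in \<open>auto simp: I_lc_eq\<close>)
      moreover have "\<bar>x i - g i\<bar> \<le> \<epsilon>"
        using x(2) i' by (simp add: I_lc_eq)
      ultimately show ?thesis by linarith
    next
      assume "\<exists>bseq bsum. sound_combinations bseq bsum \<and> gsc = bu_gsc bseq bsum D w \<epsilon>"
      then obtain bseq bsum where sound: "sound_combinations bseq bsum"
        and "gsc = bu_gsc bseq bsum D w \<epsilon>"
        by blast
      then have "sup0 (wsum (sem D) w ` bottom_up bseq bsum (upper C) D i) \<le> g i + \<epsilon>"
        using stop i by (simp add: bu_gsc_def)
      then show ?thesis
        using WRPr_max_le_over_approx[of "sem D" w, OF omdp _ over_approx_bottom_up[OF sound C D] i] w'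
        by force
    qed
    ultimately show ?thesis
      using g[OF i'] i by (simp add: f)
  qed
  then show ?thesis by auto
qed

end
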